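(* Let $X$ be an $\epsilon$-space. Then the following are equivalent: (1) ${\sf S}_1(\Omega_X,\Omega_X)$; (2) ${\sf E}(\Omega_X,\Omega_X)$; (3) ${\sf GP}(\Omega_X,\Omega_X)$; (4) ${\sf FG}(\Omega_X,\Omega_X)$; (5) ${\sf NW}(\Omega_X,\Omega_X)$; (6) for all positive integers $n$ and $k$, $\Omega_X\rightarrow(\Omega_X)^n_k$; (7) $\Omega_X\rightarrow(\Omega_X)^2_2$.
   Context: For a topological space $X$, an $\omega$-cover of $X$ is an open cover $\mathcal{U}$ of $X$ with $X\notin\mathcal{U}$ such that every finite $F\subseteq X$ is contained in some member of $\mathcal{U}$; $\Omega_X$ denotes the set of $\omega$-covers of $X$. $X$ is an $\epsilon$-space if every $\omega$-cover of $X$ contains a countable subset which is an $\omega$-cover. ${\sf S}_1(\Omega_X,\Omega_X)$ means: for every sequence $(\mathcal{U}_n:n\in\mathbb{N})$ of $\omega$-covers of $X$ there are $U_n\in\mathcal{U}_n$ such that $\{U_n:n\in\mathbb{N}\}$ is an $\omega$-cover of $X$. For a set $S$, $[S]^{\aleph_0}$ is the set of countably infinite subsets of $S$, $[S]^{<\aleph_0}$ the set of finite subsets, $[S]^n$ the set of $n$-element subsets. For a countably infinite set $A$ fix a bijective enumeration $A=\{a_n:n\in\mathbb{N}\}$. For $s,T\subseteq A$ write $s<T$ if whenever $a_n\in s$ and $a_m\in T$ we have $n<m$ (vacuous if $s=\emptyset$). For $B\subseteq A$ and finite $s\subseteq A$ let $B|s=\{a_n\in B: s<\{a_n\}\}$.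 For finite $s\subseteq A$ and infinite $C\subseteq A$ with $s<C$ put $[s,C]=\{s\cup D: D\in[A]^{\aleph_0},\ D\subseteq C\}$. These sets form a base of the Ellentuck topology on $[A]^{\aleph_0}$; $[A]^{\aleph_0}\cap\Omega_X$ carries the subspace topology. The $2^{\mathbb{N}}$ topology on $[A]^{\aleph_0}$ is the one obtained by identifying each subset of $A$ with its characteristic function in $\{0,1\}^{\mathbb{N}}$ (via the enumeration) with the product topology. A set has the Baire property if it is of the form $(U\setminus M)\cup(M\setminus U)$ with $U$ open and $M$ meager (countable union of nowhere dense sets). A finite $s\subseteq C$ is an initial segment of $C\subseteq A$ if $s<C\setminus s$. ${\sf E}(\Omega_X,\Omega_X)$: for every countably infinite $A\in\Omega_X$ and every $R\subseteq[A]^{\aleph_0}\cap\Omega_X$ which has the Baire property in the Ellentuck topology on $[A]^{\aleph_0}\cap\Omega_X$, the following holds: for each $S\subseteq A$ with $S\in\Omega_X$ and each finite $s\subseteq A$ there is an infinite $B\subseteq S|s$ with $B\in\Omega_X$ such that either $[s,B]\cap\Omega_X\subseteq R$ or $[s,B]\cap\Omega_X\cap R=\emptyset$. ${\sf GP}(\Omega_X,\Omega_X)$: for every countably infinite $A\in\Omega_X$ and every $R\subseteq[A]^{\aleph_0}\cap\Omega_X$ open in the $2^{\mathbb{N}}$ topology on $[A]^{\aleph_0}\cap\Omega_X$, for each $S\in[A]^{\aleph_0}\cap\Omega_X$ there is $B\in[S]^{\aleph_0}\cap\Omega_X$ with either $[B]^{\aleph_0}\cap\Omega_X\subseteq R$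 or $[B]^{\aleph_0}\cap\Omega_X\cap R=\emptyset$. A family $\mathcal{S}\subseteq[A]^{<\aleph_0}$ is dense if $\mathcal{S}\cap[B]^{<\aleph_0}\neq\emptyset$ for every $B\in[A]^{\aleph_0}\cap\Omega_X$, and thin if no element of $\mathcal{S}$ is an initial segment of another element of $\mathcal{S}$. ${\sf FG}(\Omega_X,\Omega_X)$: for every countably infinite $A\in\Omega_X$ and every dense $\mathcal{S}\subseteq[A]^{<\aleph_0}$ there is $B\in[A]^{\aleph_0}\cap\Omega_X$ such that every $C\in[B]^{\aleph_0}\cap\Omega_X$ has an initial segment in $\mathcal{S}$. ${\sf NW}(\Omega_X,\Omega_X)$: for every countably infinite $A\in\Omega_X$, every thin $\mathcal{T}\subseteq[A]^{<\aleph_0}$, every $n$ and every partition $\mathcal{T}=\mathcal{T}_1\cup\cdots\cup\mathcal{T}_n$ there are $B\in[A]^{\aleph_0}\cap\Omega_X$ and $i\in\{1,\dots,n\}$ with $[B]^{<\aleph_0}\cap\mathcal{T}\subseteq\mathcal{T}_i$. $\Omega_X\rightarrow(\Omega_X)^n_k$: for every countable $A\in\Omega_X$ and every $f:[A]^n\to\{1,\dots,k\}$ there are $B\in[A]^{\aleph_0}\cap\Omega_X$ and $i$ such that $f$ is constantly $i$ on $[B]^n$. *)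

theory Defs
  imports "HOL-Analysis.Analysis" "HOL-Library.Ramsey"
begin

subsection \<open>Omega-covers and selection\<close>

definition Omega :: "'a topology \<Rightarrow> 'a set set set" where
  "Omega X = {\<U>. (\<forall>U\<in>\<U>. openin X U) \<and> \<Union>\<U> = topspace X \<and> topspace X \<notin> \<U> \<and>
                  (\<forall>F. finite F \<and> F \<subseteq> topspace X \<longrightarrow> (\<exists>U\<in>\<U>. F \<subseteq> U))}"

definition epsilon_space :: "'a topology \<Rightarrow> bool" where
  "epsilon_space X \<longleftrightarrow> (\<forall>\<U>\<in>Omega X. \<exists>\<V>\<subseteq>\<U>. countable \<V> \<and> \<V> \<in> Omega X)"

definition S1 :: "'b set set \<Rightarrow> 'b set set \<Rightarrow> bool" where
  "S1 \<A> \<B> \<longleftrightarrow>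
     (\<forall>\<U> :: nat \<Rightarrow> 'b set. (\<forall>n. \<U> n \<in> \<A>) \<longrightarrow>
        (\<exists>u. (\<forall>n. u n \<in> \<U> n) \<and> range u \<in> \<B>))"

subsection \<open>Combinatorics of an enumerated set\<close>

definition inf_subsets :: "'b set \<Rightarrow> 'b set set" where
  "inf_subsets S = {B. B \<subseteq> S \<and> countable B \<and> infinite B}"

text \<open>
  Below, \<open>a :: nat \<Rightarrow> 'b\<close> stands for the chosen bijective enumeration of the ambient countably
  infinite set \<open>A\<close>. Finite subsets of \<open>S\<close> are given by \<^const>\<open>Fpow\<close>, and \<open>n\<close>-element subsets
  by \<^const>\<open>nsets\<close>.
\<close>

definition enum_less :: "(nat \<Rightarrow> 'b) \<Rightarrow> 'b set \<Rightarrow> 'b set \<Rightarrow> bool" where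
  "enum_less a s T \<longleftrightarrow> (\<forall>n m. a n \<in> s \<longrightarrow> a m \<in> T \<longrightarrow> n < m)"

text \<open>The set $B|s$.\<close>

definition enum_above :: "(nat \<Rightarrow> 'b) \<Rightarrow> 'b set \<Rightarrow> 'b set \<Rightarrow> 'b set" where
  "enum_above a B s = {a n |n. a n \<in> B \<and> enum_less a s {a n}}"

definition initial_segment :: "(nat \<Rightarrow> 'b) \<Rightarrow> 'b set \<Rightarrow> 'b set \<Rightarrow> bool" where
  "initial_segment a s C \<longleftrightarrow> finite s \<and> s \<subseteq> C \<and> enum_less a s (C - s)"

definition thin :: "(nat \<Rightarrow> 'b) \<Rightarrow> 'b set set \<Rightarrow> bool" where
  "thin a \<T> \<longleftrightarrow> (\<forall>s\<in>\<T>. \<forall>t\<in>\<T>. s \<noteq> t \<longrightarrow> \<not> initial_segment a s t)"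

definition dense_family :: "'a topology \<Rightarrow> 'a set set \<Rightarrow> 'a set set set \<Rightarrow> bool" where
  "dense_family X A \<S> \<longleftrightarrow> (\<forall>B \<in> inf_subsets A \<inter> Omega X. \<S> \<inter> Fpow B \<noteq> {})"

subsection \<open>Topologies on the countably infinite subsets\<close>

text \<open>The set $[s,C]$.\<close>

definition ellentuck_set :: "'b set \<Rightarrow> 'b set \<Rightarrow> 'b set \<Rightarrow> 'b set set" where
  "ellentuck_set A s C = {s \<union> D |D. D \<in> inf_subsets A \<and> D \<subseteq> C}"

definition ellentuck_topology :: "(nat \<Rightarrow> 'b) \<Rightarrow> 'b set \<Rightarrow> 'b set topology" where
  "ellentuck_topology a A =
     topology_generated_by
       {ellentuck_set A s C |s C. s \<in> Fpow A \<and> C \<subseteq> A \<and> infinite C \<and> enum_less a s C}"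

definition cantor_topology :: "(nat \<Rightarrow> 'b) \<Rightarrow> 'b set \<Rightarrow> 'b set topology" where
  "cantor_topology a A =
     pullback_topology (inf_subsets A) (\<lambda>B n. a n \<in> B)
       (product_topology (\<lambda>n::nat. discrete_topology (UNIV :: bool set)) UNIV)"

definition nowhere_dense_in :: "'b topology \<Rightarrow> 'b set \<Rightarrow> bool" where
  "nowhere_dense_in T N \<longleftrightarrow> N \<subseteq> topspace T \<and> T interior_of (T closure_of N) = {}"

definition meager_in :: "'b topology \<Rightarrow> 'b set \<Rightarrow> bool" where
  "meager_in T M \<longleftrightarrow> (\<exists>\<N>. countable \<N> \<and> (\<forall>N\<in>\<N>. nowhere_dense_in T N) \<and> M = \<Union>\<N>)"

definition baire_property_in :: "'b topology \<Rightarrow> 'b set \<Rightarrow> bool" where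
  "baire_property_in T R \<longleftrightarrow> (\<exists>U M. openin T U \<and> meager_in T M \<and> R = (U - M) \<union> (M - U))"

subsection \<open>The Ramsey-type properties\<close>

text \<open>
  The argument \<open>enum\<close> assigns to every countably infinite set \<open>A\<close> the bijective enumeration
  \<open>enum A\<close> that is fixed for it.
\<close>

definition E_property :: "('a set set \<Rightarrow> nat \<Rightarrow> 'a set) \<Rightarrow> 'a topology \<Rightarrow> bool" where
  "E_property enum X \<longleftrightarrow>
     (\<forall>A R. A \<in> Omega X \<and> countable A \<and> infinite A \<and> R \<subseteq> inf_subsets A \<inter> Omega X \<and>
        baire_property_in (subtopology (ellentuck_topology (enum A) A) (Omega X)) R \<longrightarrow>
        (\<forall>S s. S \<subseteq> A \<and> S \<in> Omega X \<and> s \<in> Fpow A \<longrightarrow>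
           (\<exists>B. B \<subseteq> enum_above (enum A) S s \<and> infinite B \<and> B \<in> Omega X \<and>
              (ellentuck_set A s B \<inter> Omega X \<subseteq> R \<or>
               ellentuck_set A s B \<inter> Omega X \<inter> R = {}))))"

definition GP_property :: "('a set set \<Rightarrow> nat \<Rightarrow> 'a set) \<Rightarrow> 'a topology \<Rightarrow> bool" where
  "GP_property enum X \<longleftrightarrow>
     (\<forall>A R. A \<in> Omega X \<and> countable A \<and> infinite A \<and> R \<subseteq> inf_subsets A \<inter> Omega X \<and>
        openin (subtopology (cantor_topology (enum A) A) (Omega X)) R \<longrightarrow>
        (\<forall>S \<in> inf_subsets A \<inter> Omega X. \<exists>B \<in> inf_subsets S \<inter> Omega X.
            inf_subsets B \<inter> Omega X \<subseteq> R \<or> inf_subsets B \<inter> Omega X \<inter> R = {}))"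

definition FG_property :: "('a set set \<Rightarrow> nat \<Rightarrow> 'a set) \<Rightarrow> 'a topology \<Rightarrow> bool" where
  "FG_property enum X \<longleftrightarrow>
     (\<forall>A \<S>. A \<in> Omega X \<and> countable A \<and> infinite A \<and> \<S> \<subseteq> Fpow A \<and> dense_family X A \<S> \<longrightarrow>
        (\<exists>B \<in> inf_subsets A \<inter> Omega X. \<forall>C \<in> inf_subsets B \<inter> Omega X.
            \<exists>s\<in>\<S>. initial_segment (enum A) s C))"

text \<open>As usual in partition calculus, classes of a partition are allowed to be empty.\<close>

definition NW_property :: "('a set set \<Rightarrow> nat \<Rightarrow> 'a set) \<Rightarrow> 'a topology \<Rightarrow> bool" where
  "NW_property enum X \<longleftrightarrow>
     (\<forall>A \<T> (n::nat) P. A \<in> Omega X \<and> countable A \<and> infinite A \<and>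
        \<T> \<subseteq> Fpow A \<and> thin (enum A) \<T> \<and>
        n \<ge> 1 \<and> \<T> = (\<Union>i\<in>{1..n}. P i) \<and> disjoint_family_on P {1..n} \<longrightarrow>
        (\<exists>B \<in> inf_subsets A \<inter> Omega X. \<exists>i\<in>{1..n}. Fpow B \<inter> \<T> \<subseteq> P i))"

definition omega_arrow :: "'a topology \<Rightarrow> nat \<Rightarrow> nat \<Rightarrow> bool" where
  "omega_arrow X n k \<longleftrightarrow>
     (\<forall>A f. A \<in> Omega X \<and> countable A \<and> f \<in> nsets A n \<rightarrow> {1..k} \<longrightarrow>
        (\<exists>B \<in> inf_subsets A \<inter> Omega X. \<exists>i\<in>{1..k}. \<forall>p \<in> nsets B n. f p = i))"

end

theory Submission
  imports Defs
begin

text \<open>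
  Let \<open>A\<close> be a countable omega-cover, identified with the natural numbers by its enumeration. Its
  subsets that are omega-covers form a coideal, and the selection principle makes this coideal
  selective: a diagonal choice gives, for a decreasing sequence in the coideal, a member almost
  contained in every term, and selecting intersections of \<open>n + 1\<close> members from distinct finite
  blocks thins it out to one element per block. No game is needed. For a selective coideal the
  classical accept/reject fusion argument gives the Ellentuck theorem relative to the coideal,
  from which the Galvin-Prikry, Galvin and Nash-Williams properties follow. The way back to the
  selection principle is the pair colouring of the cover \<open>{u 0 n \<inter> u n m}\<close> that records whether
  the two indices \<open>n\<close> agree.
\<close>

section \<open>Selective coideals on the natural numbers\<close>

text \<open>Members of a coideal, unlike those of an ultrafilter, need not meet inside it, so
  homogeneous sets obtained for different finite stems cannot simply be intersected. Each choice is
  made inside the previous one, and infinitely many choices are reconciled by selectivity. The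
  substitute for maximality is that one part of any splitting into two stays in the coideal; this
  lets rejection pass from a stem to its one-point extensions. The diagonal choice alone may take
  many elements from one block. The number \<open>n + 1\<close> in the second choice leaves room for
  a fresh block after \<open>n\<close> earlier ones. One element per block is still not enough,
  because neighbouring blocks can be too close together; keeping the blocks of one parity repairs
  this. The Galvin property concerns dense families rather than partitions, and it is asked only for
  the relation with pairs and two colours. That suffices, since the way back to selection starts
  from exactly this relation.\<close>

definition tail :: "nat set \<Rightarrow> nat set \<Rightarrow> nat set" where
  "tail B s = {n \<in> B. \<forall>m\<in>s. m < n}"

lemma tail_subset: "tail B s \<subseteq> B"
  by (auto simp: tail_def)

lemma tail_mono: "B \<subseteq> C \<Longrightarrow> tail B s \<subseteq> tail C s"
  by (auto simp: tail_def)

lemma tail_tail [simp]: "tail (tail B s) s = tail B s"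
  by (auto simp: tail_def)

text \<open>By \<open>upward\<close> and \<open>split\<close> the sets outside \<open>H\<close> form
  an ideal, and by \<open>infinite\<close> it contains all finite sets. Selectivity is stated as a
  diagonal intersection indexed by elements of \<open>B\<close> itself, so that the largest element
  of a finite stem names the term \<open>V i\<close> that controls what comes after it.\<close>

locale selective_coideal =
  fixes H :: "nat set set"
  assumes upward: "B \<in> H \<Longrightarrow> B \<subseteq> C \<Longrightarrow> C \<in> H"
    and split: "B \<union> C \<in> H \<Longrightarrow> B \<in> H \<or> C \<in> H"
    and infinite: "B \<in> H \<Longrightarrow> infinite B"
    and selective: "(\<And>i. V i \<in> H) \<Longrightarrow> decseq V \<Longrightarrow>
          \<exists>B\<in>H. B \<subseteq> V 0 \<and> (\<forall>i\<in>B. \<forall>j\<in>B. i < j \<longrightarrow> j \<in> V i)"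
begin

lemma Diff_finite: "B \<in> H \<Longrightarrow> finite F \<Longrightarrow> B - F \<in> H"
  using split[of "B - F" "B \<inter> F"] infinite[of "B \<inter> F"] by (auto simp: Un_Diff_Int)

lemma tail_in: "B \<in> H \<Longrightarrow> finite s \<Longrightarrow> tail B s \<in> H"
proof -
  assume B: "B \<in> H" and s: "finite s"
  then obtain m where m: "s \<subseteq> {..m}" using finite_nat_iff_bounded_le by auto
  have "B - {..m} \<in> H" using B by (rule Diff_finite) simp
  then show ?thesis by (rule upward) (use m in \<open>auto simp: tail_def\<close>)
qed

text \<open>The trace on \<open>H\<close> of the Ellentuck set with stem \<open>s\<close>. The order
  condition between stem and \<open>B\<close> enters through \<open>tail\<close>, hence the frequent
  form \<open>ell t (tail B t)\<close>.\<close>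

definition ell :: "nat set \<Rightarrow> nat set \<Rightarrow> nat set set" where
  "ell s B = {C \<in> H. s \<subseteq> C \<and> C \<subseteq> s \<union> B}"

lemma ell_mono: "B \<subseteq> C \<Longrightarrow> ell s B \<subseteq> ell s C"
  by (auto simp: ell_def)

text \<open>At stage \<open>n\<close> only the finitely many stems inside \<open>{..n + m}\<close>
  have to be treated, so heredity and density give a decreasing sequence \<open>V\<close>. In a
  diagonal set \<open>B\<close>, whatever lies above a stem with last new element \<open>i\<close>
  belongs to \<open>V i\<close>, and this stem was treated at stage \<open>i\<close>.\<close>

lemma fusion:
  assumes mono: "\<And>t B B'. P t B \<Longrightarrow> B' \<in> H \<Longrightarrow> B' \<subseteq> B \<Longrightarrow> P t B'"
    and dens: "\<And>t B. finite t \<Longrightarrow> B \<in> H \<Longrightarrow> \<exists>B'\<in>H. B' \<subseteq> B \<and> P t B'"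
    and S: "S \<in> H" and s: "finite s"
  shows "\<exists>B\<in>H. B \<subseteq> tail S s \<and> (\<forall>t. finite t \<and> s \<subseteq> t \<and> t \<subseteq> s \<union> B \<longrightarrow> P t (tail B t))"
proof -
  obtain m where m: "s \<subseteq> {..m}" using s finite_nat_iff_bounded_le by auto
  have fam: "\<exists>B'\<in>H. B' \<subseteq> B \<and> (\<forall>t\<in>F. P t B')" if "finite F" "\<forall>t\<in>F. finite t" "B \<in> H" for F B
    using that
  proof (induction F arbitrary: B rule: finite_induct)
    case empty
    then show ?case by blast
  next
    case (insert t F)
    then obtain B1 where B1: "B1 \<in> H" "B1 \<subseteq> B" "\<forall>t\<in>F. P t B1" by blast
    obtain B2 where "B2 \<in> H" "B2 \<subseteq> B1" "P t B2" using dens[of t B1] insert B1 by auto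
    then show ?case using B1 mono by (intro bexI[of _ B2]) auto
  qed
  have step: "\<exists>B'\<in>H. B' \<subseteq> B \<and> (\<forall>t\<in>Pow {..n}. P t B')" if "B \<in> H" for B n
    by (rule fam) (use that in \<open>auto intro: finite_subset\<close>)
  have "\<exists>V. \<forall>n. (V n \<in> H \<and> V n \<subseteq> tail S s \<and> (\<forall>t\<in>Pow {..n + m}. P t (V n))) \<and> V (Suc n) \<subseteq> V n"
  proof (rule dependent_nat_choice)
    show "\<exists>x. x \<in> H \<and> x \<subseteq> tail S s \<and> (\<forall>t\<in>Pow {..0 + m}. P t x)"
      using step[OF tail_in[OF S s], of "0 + m"] by blast
  next
    fix x n assume "x \<in> H \<and> x \<subseteq> tail S s \<and> (\<forall>t\<in>Pow {..n + m}. P t x)"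
    then show "\<exists>y. (y \<in> H \<and> y \<subseteq> tail S s \<and> (\<forall>t\<in>Pow {..Suc n + m}. P t y)) \<and> y \<subseteq> x"
      using step[of x "Suc n + m"] by blast
  qed
  then obtain V where V: "\<And>n. V n \<in> H" "\<And>n. V n \<subseteq> tail S s"
      "\<And>n t. t \<subseteq> {..n + m} \<Longrightarrow> P t (V n)" "\<And>n. V (Suc n) \<subseteq> V n" by blast
  obtain B where B: "B \<in> H" "B \<subseteq> V 0" "\<And>i j. i \<in> B \<Longrightarrow> j \<in> B \<Longrightarrow> i < j \<Longrightarrow> j \<in> V i"
    using selective[of V] V by (auto simp: decseq_Suc_iff)
  have "P t (tail B t)" if t: "finite t" "s \<subseteq> t" "t \<subseteq> s \<union> B" for t
  proof (cases "t = s")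
    \<comment> \<open>The stem \<open>s\<close> has no new element to name a stage; stage 0 treats
      it because \<open>m\<close> bounds \<open>s\<close>.\<close>
    case True
    then show ?thesis using V(3)[of t 0] m B mono tail_in[OF B(1) t(1)] tail_subset[of B t] by fastforce
  next
    case False
    define i where "i = Max (t - s)"
    have ne: "t - s \<noteq> {}" "finite (t - s)" using False t by auto
    have i: "i \<in> B" "i \<in> t" using Max_in[OF ne(2,1)] t by (auto simp: i_def)
    have "t \<subseteq> {..i + m}"
    proof
      fix j assume "j \<in> t"
      then show "j \<in> {..i + m}" using m Max_ge[OF ne(2), of j] by (cases "j \<in> s") (auto simp: i_def)
    qed
    moreover have "tail B t \<subseteq> V i" using B(3) i by (auto simp: tail_def)
    ultimately show ?thesis using V(3) mono tail_in[OF B(1) t(1)] by blast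
  qed
  moreover have "B \<subseteq> tail S s" using B(2) V(2) by blast
  ultimately show ?thesis using B(1) by blast
qed

text \<open>Openness in the Ellentuck topology: \<open>ell (C \<inter> {..<n}) (C - {..<n})\<close>, for varying \<open>n\<close>,
  is a neighbourhood base at \<open>C\<close>.\<close>

definition ell_open :: "nat set set \<Rightarrow> bool" where
  "ell_open R \<longleftrightarrow> (\<forall>C\<in>R. \<exists>n. \<forall>C'\<in>H. C' \<subseteq> C \<and> C' \<inter> {..<n} = C \<inter> {..<n} \<longrightarrow> C' \<in> R)"

text \<open>A first fusion makes \<open>B\<close> accept or reject every stem; a second makes
  rejection pass from \<open>t\<close> to \<open>insert b t\<close>. If \<open>s\<close> is not
  accepted, every finite stem built from \<open>s\<close> and \<open>B'\<close> is then rejected.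
  This excludes \<open>R\<close>, because for \<open>C\<close> in \<open>R\<close> openness makes a
  tail of \<open>C\<close> accept an initial segment of \<open>C\<close>.\<close>

lemma open_Ramsey:
  assumes R: "ell_open R" and S: "S \<in> H" and s: "finite s"
  shows "\<exists>B\<in>H. B \<subseteq> tail S s \<and> (ell s B \<subseteq> R \<or> ell s B \<inter> R = {})"
proof -
  define acc where "acc B t \<longleftrightarrow> ell t (tail B t) \<subseteq> R" for B t
  have acc_mono: "acc B' t" if "acc B t" "B' \<subseteq> B" for B B' t
    using that ell_mono[OF tail_mono[OF that(2)], of t t] by (auto simp: acc_def)
  define P where "P t B \<longleftrightarrow> acc B t \<or> (\<forall>B'\<in>H. B' \<subseteq> B \<longrightarrow> \<not> acc B' t)" for t B
  have "\<exists>B\<in>H. B \<subseteq> tail S s \<and> (\<forall>t. finite t \<and> s \<subseteq> t \<and> t \<subseteq> s \<union> B \<longrightarrow> P t (tail B t))"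
  proof (rule fusion[OF _ _ S s])
    show "P t B'" if "P t B" "B' \<in> H" "B' \<subseteq> B" for t B B'
      using that acc_mono unfolding P_def by blast
    show "\<exists>B'\<in>H. B' \<subseteq> B \<and> P t B'" if "finite t" "B \<in> H" for t B
      using that unfolding P_def by blast
  qed
  then obtain B where B: "B \<in> H" "B \<subseteq> tail S s"
    and PB: "\<And>t. finite t \<Longrightarrow> s \<subseteq> t \<Longrightarrow> t \<subseteq> s \<union> B \<Longrightarrow> P t (tail B t)" by blast
  have tBs: "tail B s = B" using B(2) by (auto simp: tail_def)
  \<comment> \<open>Rejection refers to the fixed \<open>B\<close> of the first fusion, so it is not
    affected by the later passage to \<open>B'\<close>.\<close>
  define rej where "rej t \<longleftrightarrow> (\<forall>B'\<in>H. B' \<subseteq> tail B t \<longrightarrow> \<not> acc B' t)" for t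
  have dec: "acc B t \<or> rej t" if "finite t" "s \<subseteq> t" "t \<subseteq> s \<union> B" for t
    using PB[OF that] by (auto simp: P_def rej_def acc_def)
  show ?thesis
  proof (cases "acc B s")
    case True
    then show ?thesis using B by (auto simp: acc_def tBs)
  next
    case False
    then have rejs: "rej s" using dec[of s] s by auto
    define Q where "Q t D \<longleftrightarrow> (s \<subseteq> t \<and> t \<subseteq> s \<union> B \<and> rej t \<longrightarrow>
        (\<forall>b\<in>tail (D \<inter> B) t. rej (insert b t)))" for t D
    have "\<exists>B'\<in>H. B' \<subseteq> tail B s \<and> (\<forall>t. finite t \<and> s \<subseteq> t \<and> t \<subseteq> s \<union> B' \<longrightarrow> Q t (tail B' t))"
    proof (rule fusion[OF _ _ B(1) s])
      show "Q t D'" if "Q t D" "D' \<in> H" "D' \<subseteq> D" for t D D'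
        using that tail_mono[of "D' \<inter> B" "D \<inter> B" t] unfolding Q_def by blast
      show "\<exists>D'\<in>H. D' \<subseteq> D \<and> Q t D'" if t: "finite t" and D: "D \<in> H" for t D
      proof (cases "s \<subseteq> t \<and> t \<subseteq> s \<union> B \<and> rej t")
        case False
        then show ?thesis using D unfolding Q_def by blast
      next
        case True
        \<comment> \<open>\<open>E\<close> collects the accepted one-point extensions of
          \<open>t\<close>. In \<open>H\<close> it would accept \<open>t\<close> itself, contrary to
          \<open>rej t\<close>; hence \<open>split\<close> keeps \<open>D - E\<close>.\<close>
        define E where "E = {b \<in> tail (D \<inter> B) t. \<not> rej (insert b t)}"
        have ED: "E \<subseteq> D" "E \<subseteq> B" "E \<subseteq> tail B t" by (auto simp: E_def tail_def)
        have "acc E t"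
          unfolding acc_def
        proof
          fix C assume C: "C \<in> ell t (tail E t)"
          then have CH: "C \<in> H" and tC: "t \<subseteq> C" and Ct: "C \<subseteq> t \<union> tail E t" by (auto simp: ell_def)
          have "C - t \<noteq> {}" using infinite[OF CH] t by (metis finite.emptyI finite_Diff2)
          \<comment> \<open>As \<open>b\<close> is least, the rest of \<open>C\<close> lies above
            \<open>insert b t\<close>, which puts \<open>C\<close> among the sets that
            \<open>B\<close> accepts for this stem.\<close>
          then obtain b where b: "b \<in> C - t" and least: "\<And>x. x \<in> C - t \<Longrightarrow> b \<le> x"
            using LeastI_ex[of "\<lambda>x. x \<in> C - t"] Least_le[of "\<lambda>x. x \<in> C - t"] by blast
          have bE: "b \<in> E" using b Ct tail_subset[of E t] by blast
          then have "b \<in> B" "\<not> rej (insert b t)" using ED by (auto simp: E_def)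
          then have "acc B (insert b t)" using dec[of "insert b t"] t True by auto
          moreover have "C \<in> ell (insert b t) (tail B (insert b t))"
          proof -
            have "x \<in> tail B (insert b t)" if x: "x \<in> C" "x \<notin> insert b t" for x
            proof -
              have "x \<in> tail E t" using x Ct by auto
              then have "x \<in> B" "\<forall>m\<in>t. m < x" using ED by (auto simp: tail_def)
              moreover have "b < x" using least[of x] x by force
              ultimately show ?thesis by (auto simp: tail_def)
            qed
            then show ?thesis using CH tC b by (auto simp: ell_def)
          qed
          ultimately show "C \<in> R" by (auto simp: acc_def)
        qed
        then have "E \<notin> H" using True ED by (auto simp: rej_def)
        then have "D - E \<in> H" using split[of E "D - E"] D ED by (simp add: Un_absorb1)
        moreover have "Q t (D - E)" by (auto simp: Q_def E_def tail_def)
        ultimately show ?thesis by blast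
      qed
    qed
    then obtain B' where B': "B' \<in> H" "B' \<subseteq> B"
      and QB': "\<And>t. finite t \<Longrightarrow> s \<subseteq> t \<Longrightarrow> t \<subseteq> s \<union> B' \<Longrightarrow> Q t (tail B' t)" by (auto simp: tBs)
    have B's: "\<And>b m. b \<in> B' \<Longrightarrow> m \<in> s \<Longrightarrow> m < b" using B'(2) B(2) by (auto simp: tail_def)
    \<comment> \<open>The elements are added in increasing order, since \<open>Q\<close> speaks only
      of extensions above the stem.\<close>
    have rej_un: "rej (s \<union> u)" if "finite u" "u \<subseteq> B'" for u
      using that
    proof (induction u rule: finite_linorder_max_induct)
      case empty
      then show ?case using rejs by simp
    next
      case (insert b u)
      then have "rej (s \<union> u)" "Q (s \<union> u) (tail B' (s \<union> u))" using QB'[of "s \<union> u"] s by auto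
      moreover have "b \<in> tail (tail B' (s \<union> u) \<inter> B) (s \<union> u)"
        using insert B's B' by (auto simp: tail_def)
      ultimately have "rej (insert b (s \<union> u))" using insert B' unfolding Q_def by blast
      then show ?case by simp
    qed
    have "ell s B' \<inter> R = {}"
    proof (rule ccontr)
      assume "ell s B' \<inter> R \<noteq> {}"
      then obtain C where C: "C \<in> R" "C \<in> H" "s \<subseteq> C" "C \<subseteq> s \<union> B'" by (auto simp: ell_def)
      obtain n where "\<forall>C'\<in>H. C' \<subseteq> C \<and> C' \<inter> {..<n} = C \<inter> {..<n} \<longrightarrow> C' \<in> R"
        using bspec[OF R[unfolded ell_open_def] C(1)] by (elim exE)
      then have n: "\<And>C'. C' \<in> H \<Longrightarrow> C' \<subseteq> C \<Longrightarrow> C' \<inter> {..<n} = C \<inter> {..<n} \<Longrightarrow> C' \<in> R"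
        by simp
      obtain m where m: "s \<subseteq> {..<m}" using s finite_nat_iff_bounded by auto
      \<comment> \<open>Agreement with \<open>C\<close> below \<open>n\<close> guarantees membership
        in \<open>R\<close>; \<open>m\<close> makes \<open>t\<close> contain all of
        \<open>s\<close>.\<close>
      define k where "k = max n m"
      define t where "t = C \<inter> {..<k}"
      have "t = s \<union> (t - s)" using C m by (auto simp: t_def k_def)
      moreover have "rej (s \<union> (t - s))" by (rule rej_un) (use C in \<open>auto simp: t_def\<close>)
      ultimately have "rej t" by simp
      moreover have "C - {..<k} \<in> H" using C by (simp add: Diff_finite)
      moreover have "C - {..<k} \<subseteq> tail B t"
      proof
        fix x assume x: "x \<in> C - {..<k}"
        then have "x \<notin> s" using m by (auto simp: k_def)
        then have "x \<in> B" using x C(4) B'(2) by auto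
        then show "x \<in> tail B t" using x by (auto simp: tail_def t_def)
      qed
      moreover have "acc (C - {..<k}) t"
        unfolding acc_def ell_def
        by (auto intro!: n simp: tail_def t_def k_def)
      ultimately show False by (auto simp: rej_def)
    qed
    then show ?thesis using B' B(2) by blast
  qed
qed

text \<open>Avoidable sets are closed under countable unions. Each stem \<open>t\<close> is
  responsible only for the sets \<open>N n\<close> with \<open>n \<le> card t\<close>, so finitely
  many shrinkings give density; a member of \<open>ell s B\<close> has arbitrarily long initial
  segments and thus avoids every \<open>N n\<close>.\<close>

lemma null_UN:
  assumes null: "\<And>n s S. finite s \<Longrightarrow> S \<in> H \<Longrightarrow> \<exists>B\<in>H. B \<subseteq> tail S s \<and> ell s B \<inter> N n = {}"
    and S: "S \<in> H" and s: "finite s"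
  shows "\<exists>B\<in>H. B \<subseteq> tail S s \<and> ell s B \<inter> (\<Union>n::nat. N n) = {}"
proof -
  define P where "P t B \<longleftrightarrow> (\<forall>n\<le>card t. ell t (tail B t) \<inter> N n = {})" for t B
  have "\<exists>B\<in>H. B \<subseteq> tail S s \<and> (\<forall>t. finite t \<and> s \<subseteq> t \<and> t \<subseteq> s \<union> B \<longrightarrow> P t (tail B t))"
  proof (rule fusion[OF _ _ S s])
    show "P t B'" if "P t B" "B' \<in> H" "B' \<subseteq> B" for t B B'
      using that ell_mono[OF tail_mono[OF that(3)], of t t] unfolding P_def by blast
    have "\<exists>B'\<in>H. B' \<subseteq> B \<and> (\<forall>n<k. ell t (tail B' t) \<inter> N n = {})"
      if t: "finite t" and B: "B \<in> H" for t B k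
    proof (induction k)
      case 0
      then show ?case using B by auto
    next
      case (Suc k)
      then obtain B' where B': "B' \<in> H" "B' \<subseteq> B" "\<forall>n<k. ell t (tail B' t) \<inter> N n = {}" by blast
      obtain D where D: "D \<in> H" "D \<subseteq> tail B' t" "ell t D \<inter> N k = {}" using null[OF t B'(1)] by blast
      have "D \<subseteq> B'" using D(2) tail_subset by blast
      then have "ell t (tail D t) \<subseteq> ell t (tail B' t)" by (intro ell_mono tail_mono)
      moreover have "ell t (tail D t) \<subseteq> ell t D" by (intro ell_mono tail_subset)
      ultimately have "\<forall>n<Suc k. ell t (tail D t) \<inter> N n = {}"
        using B'(3) D(3) unfolding less_Suc_eq by blast
      then show ?case using D(1) B'(2) \<open>D \<subseteq> B'\<close> by blast
    qed
    then show "\<exists>B'\<in>H. B' \<subseteq> B \<and> P t B'" if "finite t" "B \<in> H" for t B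
      using that unfolding P_def by (metis less_Suc_eq_le)
  qed
  then obtain B where B: "B \<in> H" "B \<subseteq> tail S s"
    and PB: "\<And>t. finite t \<Longrightarrow> s \<subseteq> t \<Longrightarrow> t \<subseteq> s \<union> B \<Longrightarrow> P t (tail B t)" by blast
  have "C \<notin> N n" if C: "C \<in> ell s B" for C n
  proof -
    have CH: "C \<in> H" and sC: "s \<subseteq> C" "C \<subseteq> s \<union> B" using C by (auto simp: ell_def)
    obtain u where u: "finite u" "card u = n" "u \<subseteq> C"
      using infinite_arbitrarily_large[OF infinite[OF CH]] by blast
    obtain k where k: "s \<union> u \<subseteq> {..<k}" using s u finite_nat_iff_bounded[of "s \<union> u"] by auto
    define t where "t = C \<inter> {..<k}"
    have "P t (tail B t)" by (rule PB) (use k sC in \<open>auto simp: t_def\<close>)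
    moreover have "n \<le> card t" using u k card_mono[of t u] by (auto simp: t_def)
    moreover have "C \<in> ell t (tail B t)"
      using CH sC k by (auto simp: ell_def tail_def t_def)
    ultimately show ?thesis by (auto simp: P_def)
  qed
  then show ?thesis using B by blast
qed

end

section \<open>Omega-covers\<close>

lemma Omega_iff:
  "\<U> \<in> Omega X \<longleftrightarrow> (\<forall>U\<in>\<U>. openin X U) \<and> topspace X \<notin> \<U> \<and>
     (\<forall>F. finite F \<and> F \<subseteq> topspace X \<longrightarrow> (\<exists>U\<in>\<U>. F \<subseteq> U))"
proof -
  have "\<Union>\<U> = topspace X" if *: "\<forall>U\<in>\<U>. openin X U"
    "\<forall>F. finite F \<and> F \<subseteq> topspace X \<longrightarrow> (\<exists>U\<in>\<U>. F \<subseteq> U)"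
  proof
    show "\<Union>\<U> \<subseteq> topspace X" using *(1) openin_subset by blast
    show "topspace X \<subseteq> \<Union>\<U>" using *(2)[rule_format, of "{x}" for x] by fastforce
  qed
  then show ?thesis unfolding Omega_def mem_Collect_eq by argo
qed

lemma Omega_subset_iff:
  assumes "A \<in> Omega X" "B \<subseteq> A"
  shows "B \<in> Omega X \<longleftrightarrow> (\<forall>F. finite F \<and> F \<subseteq> topspace X \<longrightarrow> (\<exists>U\<in>B. F \<subseteq> U))"
proof -
  have "\<forall>U\<in>B. openin X U" "topspace X \<notin> B" using assms unfolding Omega_iff by auto
  then show ?thesis unfolding Omega_iff by argo
qed

lemma Omega_openin: "A \<in> Omega X \<Longrightarrow> U \<in> A \<Longrightarrow> openin X U"
  by (simp add: Omega_iff)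

lemma Omega_not_topspace: "A \<in> Omega X \<Longrightarrow> U \<in> A \<Longrightarrow> \<not> topspace X \<subseteq> U"
  using openin_subset[of X U] by (auto simp: Omega_iff)

lemma Omega_finite_subset:
  assumes "A \<in> Omega X" "finite F" "F \<subseteq> topspace X"
  obtains U where "U \<in> A" "F \<subseteq> U"
  using assms by (auto simp: Omega_iff)

lemma Omega_superset:
  assumes "B \<in> Omega X" "B \<subseteq> C" "C \<subseteq> A" "A \<in> Omega X"
  shows "C \<in> Omega X"
  using assms(2) Omega_finite_subset[OF assms(1)]
  by (subst Omega_subset_iff[OF assms(4,3)]) (metis subsetD)

text \<open>Finite sets refuting \<open>B\<close> and \<open>C\<close> separately have a finite
  union refuting \<open>B \<union> C\<close>.\<close>

lemma Omega_Un:
  assumes BC: "B \<union> C \<in> Omega X"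
  shows "B \<in> Omega X \<or> C \<in> Omega X"
proof (rule ccontr)
  assume neg: "\<not> ?thesis"
  obtain F where F: "finite F" "F \<subseteq> topspace X" "\<forall>U\<in>B. \<not> F \<subseteq> U"
    using neg Omega_subset_iff[OF BC, of B] by auto
  obtain G where G: "finite G" "G \<subseteq> topspace X" "\<forall>U\<in>C. \<not> G \<subseteq> U"
    using neg Omega_subset_iff[OF BC, of C] by auto
  obtain U where "U \<in> B \<union> C" "F \<union> G \<subseteq> U"
    using Omega_finite_subset[OF BC, of "F \<union> G"] F G by auto
  then show False using F G by blast
qed

text \<open>Choosing a point omitted by each member of a finite family gives a finite set that no
  member contains.\<close>

lemma Omega_infinite:
  assumes B: "B \<in> Omega X"
  shows "infinite B"
proof
  assume fin: "finite B"
  have "\<forall>U\<in>B. \<exists>x. x \<in> topspace X \<and> x \<notin> U"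
    using Omega_not_topspace[OF B] by blast
  then obtain x where x: "\<forall>U\<in>B. x U \<in> topspace X \<and> x U \<notin> U" by metis
  then have "finite (x ` B)" "x ` B \<subseteq> topspace X" using fin by auto
  then obtain U where "U \<in> B" "x ` B \<subseteq> U" using Omega_finite_subset[OF B] by blast
  then show False using x by blast
qed

lemma Omega_Diff_finite:
  assumes "B \<in> Omega X" "finite F"
  shows "B - F \<in> Omega X"
  using Omega_Un[of "B - F" "B \<inter> F" X] Omega_infinite[of "B \<inter> F" X] assms
  by (auto simp: Un_Diff_Int)

lemma Omega_inf_subsets:
  "B \<in> Omega X \<Longrightarrow> B \<subseteq> S \<Longrightarrow> countable S \<Longrightarrow> B \<in> inf_subsets S \<inter> Omega X"
  using Omega_infinite by (auto simp: inf_subsets_def intro: countable_subset)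

section \<open>Selectivity from the selection principle\<close>

locale enumerated_cover =
  fixes X :: "'a topology" and A :: "'a set set" and a :: "nat \<Rightarrow> 'a set"
  assumes A: "A \<in> Omega X" and bij: "bij_betw a UNIV A"
begin

definition H :: "nat set set" where
  "H = {N. a ` N \<in> Omega X}"

lemma inj: "inj a" and range_a: "range a = A"
  using bij by (auto simp: bij_betw_def)

lemma countable_A: "countable A"
  using range_a by (metis countable_image countableI_type)

lemma H_upward: "B \<in> H \<Longrightarrow> B \<subseteq> C \<Longrightarrow> C \<in> H"
  using Omega_superset[of "a ` B" X "a ` C" A] A range_a by (auto simp: H_def)

lemma H_Un: "B \<union> C \<in> H \<Longrightarrow> B \<in> H \<or> C \<in> H"
  using Omega_Un[of "a ` B" "a ` C" X] by (auto simp: H_def image_Un)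

lemma H_infinite: "B \<in> H \<Longrightarrow> infinite B"
  using Omega_infinite[of "a ` B" X] by (auto simp: H_def)

lemma H_iff: "N \<in> H \<longleftrightarrow> (\<forall>F. finite F \<and> F \<subseteq> topspace X \<longrightarrow> (\<exists>i\<in>N. F \<subseteq> a i))"
  using Omega_subset_iff[OF A, of "a ` N"] range_a by (auto simp: H_def)

text \<open>What is left after discarding all members that contain \<open>F\<close> is refuted by
  \<open>F\<close>, so the discarded part is in \<open>H\<close>.\<close>

lemma H_containing:
  assumes N: "N \<in> H" and F: "finite F" "F \<subseteq> topspace X"
  shows "infinite {i \<in> N. F \<subseteq> a i}"
proof -
  have "N - {i \<in> N. F \<subseteq> a i} \<notin> H" using F unfolding H_iff by blast
  then have "{i \<in> N. F \<subseteq> a i} \<in> H"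
    using H_Un[of "{i \<in> N. F \<subseteq> a i}" "N - {i \<in> N. F \<subseteq> a i}"] N
    by (simp add: Un_absorb1)
  then show ?thesis by (rule H_infinite)
qed

text \<open>Selecting from \<open>V n\<close> an intersection of \<open>n + 1\<close> members with distinct \<open>b\<close>-values leaves
  enough room to replace it by one of these members whose \<open>b\<close>-value has not been used before.\<close>

lemma S1_transversal:
  assumes S1: "S1 (Omega X) (Omega X)" and V: "\<And>n. V n \<in> H"
    and b: "\<And>k::nat. finite {i. b i = k}"
  obtains x where "\<And>n. x n \<in> V n" "inj (\<lambda>n::nat. b (x n))" "range x \<in> H"
proof -
  define W where "W n = {\<Inter> (a ` F) |F. F \<subseteq> V n \<and> finite F \<and> card F = Suc n \<and> inj_on b F}" for n
  have "W n \<in> Omega X" for n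
    unfolding Omega_iff
  proof (intro conjI ballI allI impI notI)
    fix U assume "U \<in> W n"
    then obtain F where F: "U = \<Inter> (a ` F)" "finite F" "card F = Suc n" by (auto simp: W_def)
    have "F \<noteq> {}" using F by auto
    then show "openin X U"
      using F Omega_openin[OF A] range_a by (auto intro!: openin_Inter)
  next
    assume "topspace X \<in> W n"
    then obtain F where F: "topspace X = \<Inter> (a ` F)" "card F = Suc n" by (auto simp: W_def)
    then obtain i where i: "i \<in> F" by (metis card.empty ex_in_conv nat.distinct(1))
    then have "topspace X \<subseteq> a i" using F by auto
    then show False using Omega_not_topspace[OF A] range_a by blast
  next
    fix G assume "finite G \<and> G \<subseteq> topspace X"
    then have inf: "infinite {i \<in> V n. G \<subseteq> a i}" (is "infinite ?I") using H_containing V by blast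
    have "infinite (b ` ?I)"
    proof
      assume fin: "finite (b ` ?I)"
      have "?I \<subseteq> (\<Union>k\<in>b ` ?I. {i. b i = k})" by auto
      then show False using inf fin b by (meson finite_UN_I finite_subset)
    qed
    then obtain K where K: "finite K" "card K = Suc n" "K \<subseteq> b ` ?I"
      using infinite_arbitrarily_large by blast
    then obtain F where F: "F \<subseteq> ?I" "inj_on b F" "b ` F = K" 
      using iffD1[OF subset_image_inj K(3)] by blast
    then have "finite F" "card F = Suc n" using K card_image[of b F] finite_image_iff[of b F] by auto
    then have "\<Inter> (a ` F) \<in> W n" using F by (auto simp: W_def)
    moreover have "G \<subseteq> \<Inter> (a ` F)" using F by auto
    ultimately show "\<exists>U\<in>W n. G \<subseteq> U" by blast
  qed
  then obtain w where w: "\<And>n. w n \<in> W n" "range w \<in> Omega X"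
    using S1 unfolding S1_def by blast
  have "\<forall>n. \<exists>F. w n = \<Inter> (a ` F) \<and> F \<subseteq> V n \<and> finite F \<and> card F = Suc n \<and> inj_on b F"
    using w(1) by (auto simp: W_def)
  then obtain F where F: "\<And>n. w n = \<Inter> (a ` F n)" "\<And>n. F n \<subseteq> V n" "\<And>n. finite (F n)"
      "\<And>n. card (F n) = Suc n" "\<And>n. inj_on b (F n)" by metis
  have "\<exists>x. \<forall>n. x n \<in> F n \<and> b (x n) \<notin> (\<lambda>m. b (x m)) ` {..<n}"
  proof (rule dependent_wellorder_choice)
    fix n :: nat and x :: "nat \<Rightarrow> nat"
    have "card ((\<lambda>m. b (x m)) ` {..<n}) < card (b ` F n)"
      using F card_image[OF F(5)] card_image_le[of "{..<n}" "\<lambda>m. b (x m)"] by (simp add: less_Suc_eq_le)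
    then have "\<not> b ` F n \<subseteq> (\<lambda>m. b (x m)) ` {..<n}"
      by (meson card_mono finite_imageI finite_lessThan leD)
    then show "\<exists>r. r \<in> F n \<and> b r \<notin> (\<lambda>m. b (x m)) ` {..<n}" by blast
  qed auto
  then obtain x where x: "\<And>n. x n \<in> F n" "\<And>n. b (x n) \<notin> (\<lambda>m. b (x m)) ` {..<n}" by blast
  have ne: "b (x m) \<noteq> b (x n)" if "m < n" for m n
  proof
    assume "b (x m) = b (x n)"
    then have "b (x n) \<in> (\<lambda>m. b (x m)) ` {..<n}" by (intro image_eqI[of _ _ m]) (use that in auto)
    then show False using x(2) by blast
  qed
  have "inj (\<lambda>n. b (x n))"
    by (rule injI) (metis ne linorder_neqE_nat)
  \<comment> \<open>Replacing the intersection \<open>w n\<close> by its factor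
    \<open>a (x n)\<close> only enlarges it, so finite sets remain covered.\<close>
  moreover have "range x \<in> H"
    unfolding H_iff
  proof (intro allI impI)
    fix G assume "finite G \<and> G \<subseteq> topspace X"
    then obtain n where "G \<subseteq> w n" using Omega_finite_subset[OF w(2)] by blast
    then show "\<exists>i\<in>range x. G \<subseteq> a i" using F(1) x(1) by blast
  qed
  ultimately show ?thesis using that x(1) F(2) by blast
qed

lemma S1_selective:
  assumes S1: "S1 (Omega X) (Omega X)" and V: "\<And>n. V n \<in> H" and dec: "decseq V"
  shows "\<exists>B\<in>H. B \<subseteq> V 0 \<and> (\<forall>i\<in>B. \<forall>j\<in>B. i < j \<longrightarrow> j \<in> V i)"
proof -
  \<comment> \<open>With the identity as \<open>b\<close>, the transversal is used only for almost
    inclusion: from place \<open>n\<close> on its terms lie in \<open>V n\<close>.\<close>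
  obtain x where x: "\<And>n. x n \<in> V n" and W: "range x \<in> H"
    using S1_transversal[where V = V and b = "\<lambda>i. i", OF S1 V] by auto
  have W0: "range x \<subseteq> V 0" using x dec unfolding decseq_def by blast
  have almost: "finite (range x - V n)" for n
  proof (rule finite_subset)
    show "range x - V n \<subseteq> x ` {..<n}"
    proof
      fix y assume "y \<in> range x - V n"
      then obtain m where "y = x m" "x m \<notin> V n" by blast
      then have "m < n" using x[of m] dec unfolding decseq_def by (meson in_mono not_less)
      then show "y \<in> x ` {..<n}" using \<open>y = x m\<close> by blast
    qed
  qed simp
  \<comment> \<open>\<open>h\<close> outruns the finitely many exceptions: elements of
    \<open>range x\<close> from \<open>h (Suc k)\<close> on lie in \<open>V (h k)\<close>. Its
    values are the block boundaries.\<close>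
  have "\<exists>h. \<forall>k. True \<and> (h k < h (Suc k) \<and> (\<forall>j\<in>range x. h (Suc k) \<le> j \<longrightarrow> j \<in> V (h k)))"
  proof (rule dependent_nat_choice)
    fix p k :: nat
    obtain q where q: "range x - V p \<subseteq> {..<q}" using almost[of p] finite_nat_iff_bounded by auto
    show "\<exists>q. True \<and> p < q \<and> (\<forall>j\<in>range x. q \<le> j \<longrightarrow> j \<in> V p)"
      by (rule exI[of _ "max q (Suc p)"]) (use q in force)
  qed simp
  then obtain h where h: "\<And>k. h k < h (Suc k)"
      "\<And>k j. j \<in> range x \<Longrightarrow> h (Suc k) \<le> j \<Longrightarrow> j \<in> V (h k)" by blast
  have smono: "strict_mono h" using h(1) by (simp add: strict_mono_Suc_iff)
  \<comment> \<open>The number of the block containing \<open>j\<close>; block \<open>k\<close> ends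
    just below \<open>h k\<close>.\<close>
  define b where "b j = (LEAST k. j < h k)" for j
  have b1: "j < h (b j)" for j
    unfolding b_def by (rule LeastI[of _ "Suc j"])
      (use strict_mono_imp_increasing[OF smono, of "Suc j"] in simp)
  have b2: "h k \<le> j" if "k < b j" for j k
    using not_less_Least[of k "\<lambda>k. j < h k"] that by (simp add: b_def)
  have b_mono: "b i \<le> b j" if "i \<le> j" for i j
    unfolding b_def[of i] by (rule Least_le) (use b1[of j] that in linarith)
  have "finite {i. b i = k}" for k
    by (rule finite_subset[of _ "{..<h k}"]) (use b1 in auto)
  then obtain y :: "nat \<Rightarrow> nat"
    where y: "\<And>n. y n \<in> range x" "inj (\<lambda>n. b (y n))" "range y \<in> H"
    using S1_transversal[where V = "\<lambda>_. range x" and b = b, OF S1 W] by metis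
  have b_inj: "inj_on b (range y)" using y(2) by (auto simp: inj_on_def)
  \<comment> \<open>An \<open>i\<close> in block \<open>k\<close> is known only to be below
    \<open>h k\<close>, while membership in \<open>V (h k)\<close> is guaranteed from
    \<open>h (Suc k)\<close> on. Chosen elements must therefore be two blocks apart, which distinct
    blocks of equal parity are.\<close>
  define Y where "Y p = {j \<in> range y. even (b j) = p}" for p
  have "range y = Y True \<union> Y False" by (auto simp: Y_def)
  then obtain p where p: "Y p \<in> H" using H_Un y(3) by metis
  have "j \<in> V i" if ij: "i \<in> Y p" "j \<in> Y p" "i < j" for i j
  proof -
    have "b i \<noteq> b j" using inj_onD[OF b_inj, of i j] ij by (auto simp: Y_def)
    moreover have "Suc (b i) \<noteq> b j"
    proof
      assume eq: "Suc (b i) = b j"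
      have "even (b i) = even (b j)" using ij by (simp add: Y_def)
      then show False by (simp flip: eq)
    qed
    ultimately have "Suc (b i) < b j" using b_mono[of i j] ij(3) by linarith
    then have "h (Suc (b i)) \<le> j" by (rule b2)
    moreover have "j \<in> range x" using ij y(1) by (auto simp: Y_def)
    ultimately have "j \<in> V (h (b i))" by (intro h(2))
    then show ?thesis using decseqD[OF dec less_imp_le[OF b1[of i]]] by blast
  qed
  moreover have "Y p \<subseteq> V 0" using W0 y(1) by (auto simp: Y_def)
  ultimately show ?thesis using p by blast
qed

lemma S1_selective_coideal:
  assumes "S1 (Omega X) (Omega X)"
  shows "selective_coideal H"
  by unfold_locales (fact H_upward H_Un H_infinite S1_selective[OF assms])+

end

section \<open>The two topologies\<close>

context enumerated_cover
begin

abbreviation subcovers :: "'a set set set" where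
  "subcovers \<equiv> inf_subsets A \<inter> Omega X"

lemma subcovers_iff: "C \<in> subcovers \<longleftrightarrow> C \<subseteq> A \<and> C \<in> Omega X"
  using Omega_inf_subsets[OF _ _ countable_A] by (auto simp: inf_subsets_def)

abbreviation ellentuck :: "'a set set topology" where
  "ellentuck \<equiv> subtopology (ellentuck_topology a A) (Omega X)"

abbreviation cantor :: "'a set set topology" where
  "cantor \<equiv> subtopology (cantor_topology a A) (Omega X)"

lemma openin_cantor_iff:
  "openin cantor R \<longleftrightarrow> R \<subseteq> subcovers \<and>
     (\<forall>C\<in>R. \<exists>n. \<forall>C'\<in>subcovers. (\<forall>i<n. a i \<in> C' \<longleftrightarrow> a i \<in> C) \<longrightarrow> C' \<in> R)"
proof
  assume "openin cantor R"
  then obtain U where U: "openin (product_topology (\<lambda>n::nat. discrete_topology (UNIV :: bool set)) UNIV) U"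
    and R: "R = (\<lambda>B n. a n \<in> B) -` U \<inter> inf_subsets A \<inter> Omega X"
    unfolding openin_subtopology cantor_topology_def openin_pullback_topology by blast
  have "\<exists>n. \<forall>C'\<in>subcovers. (\<forall>i<n. a i \<in> C' \<longleftrightarrow> a i \<in> C) \<longrightarrow> C' \<in> R" if "C \<in> R" for C
  proof -
    have "(\<lambda>n. a n \<in> C) \<in> U" using that R by simp
    then obtain V :: "nat \<Rightarrow> bool set" where V: "finite {i. V i \<noteq> UNIV}"
      "\<And>i. (a i \<in> C) \<in> V i" "Pi\<^sub>E UNIV V \<subseteq> U"
      using U unfolding openin_product_topology_alt by (force simp: PiE_iff)
    obtain n where n: "{i. V i \<noteq> UNIV} \<subseteq> {..<n}" using V(1) finite_nat_iff_bounded by auto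
    have "C' \<in> R" if C': "C' \<in> subcovers" "\<forall>i<n. a i \<in> C' \<longleftrightarrow> a i \<in> C" for C'
    proof -
      have "(a i \<in> C') \<in> V i" for i
        using C'(2) V(2)[of i] n by (cases "i < n") auto
      then have "(\<lambda>n. a n \<in> C') \<in> U" using V(3) by (auto simp: PiE_iff)
      then show ?thesis using C' R by simp
    qed
    then show ?thesis by blast
  qed
  then show "R \<subseteq> subcovers \<and>
     (\<forall>C\<in>R. \<exists>n. \<forall>C'\<in>subcovers. (\<forall>i<n. a i \<in> C' \<longleftrightarrow> a i \<in> C) \<longrightarrow> C' \<in> R)" using R by auto
next
  assume *: "R \<subseteq> subcovers \<and>
     (\<forall>C\<in>R. \<exists>n. \<forall>C'\<in>subcovers. (\<forall>i<n. a i \<in> C' \<longleftrightarrow> a i \<in> C) \<longrightarrow> C' \<in> R)"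
  then obtain n where n: "\<And>C C'. C \<in> R \<Longrightarrow> C' \<in> subcovers \<Longrightarrow>
      (\<And>i. i < n C \<Longrightarrow> a i \<in> C' \<longleftrightarrow> a i \<in> C) \<Longrightarrow> C' \<in> R" by metis
  define U where "U = {g. \<exists>C\<in>R. \<forall>i<n C. g i \<longleftrightarrow> a i \<in> C}"
  have "openin (product_topology (\<lambda>n::nat. discrete_topology (UNIV :: bool set)) UNIV) U"
    unfolding openin_product_topology_alt
  proof (intro ballI)
    fix g assume "g \<in> U"
    then obtain C where C: "C \<in> R" "\<forall>i<n C. g i \<longleftrightarrow> a i \<in> C" by (auto simp: U_def)
    define V where "V i = (if i < n C then {g i} else UNIV)" for i
    have "{i. V i \<noteq> UNIV} \<subseteq> {..<n C}" by (auto simp: V_def)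
    then have "finite {i. V i \<noteq> UNIV}" by (rule finite_subset) simp
    moreover have "g \<in> Pi\<^sub>E UNIV V" by (auto simp: V_def PiE_iff)
    moreover have "Pi\<^sub>E UNIV V \<subseteq> U"
    proof
      fix f assume f: "f \<in> Pi\<^sub>E UNIV V"
      have "f i = g i" if "i < n C" for i using PiE_mem[OF f, of i] that by (simp add: V_def)
      then show "f \<in> U" using C by (auto simp: U_def)
    qed
    ultimately show "\<exists>V. finite {i \<in> UNIV. V i \<noteq> topspace (discrete_topology UNIV)} \<and>
        (\<forall>i\<in>UNIV. openin (discrete_topology UNIV) (V i)) \<and> g \<in> Pi\<^sub>E UNIV V \<and> Pi\<^sub>E UNIV V \<subseteq> U"
      by (intro exI[of _ V]) simp
  qed
  moreover have "R = (\<lambda>B n. a n \<in> B) -` U \<inter> inf_subsets A \<inter> Omega X"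
    using * n by (auto simp: U_def)
  ultimately show "openin cantor R"
    unfolding openin_subtopology cantor_topology_def openin_pullback_topology by blast
qed

lemma openin_ellentuck_set:
  assumes "s \<in> Fpow A" "B \<subseteq> A" "infinite B" "enum_less a s B"
  shows "openin ellentuck (ellentuck_set A s B \<inter> Omega X)"
  unfolding ellentuck_topology_def
  by (intro openin_subtopology_Int topology_generated_by_Basis) (use assms in blast)

text \<open>This is the form that \<open>ell_open\<close> transcribes to index sets. Compared with
  the Cantor topology the new condition is \<open>C' \<subseteq> C\<close>: it keeps
  \<open>C'\<close> inside any basic set \<open>[s,D]\<close> around \<open>C\<close> whose stem is
  preserved, and conversely \<open>C\<close> without its members of index below \<open>n\<close> can
  serve as \<open>D\<close>.\<close>

lemma openin_ellentuck_iff: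
  "openin ellentuck R \<longleftrightarrow> R \<subseteq> subcovers \<and>
     (\<forall>C\<in>R. \<exists>n. \<forall>C'\<in>subcovers. C' \<subseteq> C \<and> (\<forall>i<n. a i \<in> C' \<longleftrightarrow> a i \<in> C) \<longrightarrow> C' \<in> R)"
proof
  assume R: "openin ellentuck R"
  let ?B = "{ellentuck_set A s C |s C. s \<in> Fpow A \<and> C \<subseteq> A \<and> infinite C \<and> enum_less a s C}"
  obtain T where T: "generate_topology_on ?B T" "R = T \<inter> Omega X"
    using R unfolding openin_subtopology ellentuck_topology_def openin_topology_generated_by_iff by blast
  \<comment> \<open>The generators range over all infinite subsets, so the induction does too; the
    restriction to omega-covers follows it.\<close>
  define G where "G T C n \<longleftrightarrow> (\<forall>C'\<in>inf_subsets A. C' \<subseteq> C \<and> (\<forall>i<n. a i \<in> C' \<longleftrightarrow> a i \<in> C) \<longrightarrow> C' \<in> T)"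
    for T C and n :: nat
  have "T \<subseteq> inf_subsets A \<and> (\<forall>C\<in>T. \<exists>n. G T C n)"
    using T(1)
  proof induction
    case Empty
    then show ?case by simp
  next
    case (Int S T)
    have "\<exists>n. G (S \<inter> T) C n" if C: "C \<in> S \<inter> T" for C
    proof -
      obtain m n where "G S C m" "G T C n" using Int C by blast
      then have "G (S \<inter> T) C (max m n)" by (simp add: G_def)
      then show ?thesis by blast
    qed
    then show ?case using Int by blast
  next
    case (UN K)
    have "G (\<Union>K) C n" if "G k C n" "k \<in> K" for C k n
      using that by (auto simp: G_def)
    then show ?case using UN by blast
  next
    case (Basis T)
    then obtain s D where s: "s \<in> Fpow A" and T: "T = ellentuck_set A s D" and D: "D \<subseteq> A" by blast
    have "finite (a -` s)" using s inj by (auto simp: Fpow_def intro: finite_vimageI)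
    then obtain n where n: "a -` s \<subseteq> {..<n}" using finite_nat_iff_bounded by auto
    have sub: "T \<subseteq> inf_subsets A"
    proof
      fix C assume "C \<in> T"
      then obtain E where "C = s \<union> E" "E \<in> inf_subsets A" by (auto simp: T ellentuck_set_def)
      then show "C \<in> inf_subsets A"
        using s by (auto simp: inf_subsets_def Fpow_def intro: countable_finite)
    qed
    have "C' \<in> T" if C: "C \<in> T" and C': "C' \<in> inf_subsets A" "C' \<subseteq> C" "\<forall>i<n. a i \<in> C' \<longleftrightarrow> a i \<in> C"
      for C C'
    proof -
      have "s \<subseteq> C" "C \<subseteq> s \<union> D" using C by (auto simp: T ellentuck_set_def)
      have "s \<subseteq> C'"
      proof
        fix x assume x: "x \<in> s"
        then obtain i where "x = a i" using s range_a by (auto simp: Fpow_def)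
        then show "x \<in> C'" using x n C'(3) \<open>s \<subseteq> C\<close> by auto
      qed
      then have "C' = s \<union> (C' - s)" by blast
      moreover have "C' - s \<in> inf_subsets A"
        using C'(1) s by (auto simp: inf_subsets_def Fpow_def)
      moreover have "C' - s \<subseteq> D" using C'(2) \<open>C \<subseteq> s \<union> D\<close> by blast
      ultimately show ?thesis unfolding T ellentuck_set_def by blast
    qed
    then have "G T C n" if "C \<in> T" for C using that unfolding G_def by blast
    then show ?case using sub by blast
  qed
  then have T': "T \<subseteq> inf_subsets A" "\<And>C. C \<in> T \<Longrightarrow> \<exists>n. G T C n"
    by auto
  have "\<exists>n. \<forall>C'\<in>subcovers. C' \<subseteq> C \<and> (\<forall>i<n. a i \<in> C' \<longleftrightarrow> a i \<in> C) \<longrightarrow> C' \<in> R" if "C \<in> R" for C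
  proof -
    obtain n where "G T C n" using T'(2)[of C] \<open>C \<in> R\<close> T(2) by auto
    then show ?thesis using T(2) unfolding G_def by (intro exI[of _ n]) auto
  qed
  then show "R \<subseteq> subcovers \<and>
     (\<forall>C\<in>R. \<exists>n. \<forall>C'\<in>subcovers. C' \<subseteq> C \<and> (\<forall>i<n. a i \<in> C' \<longleftrightarrow> a i \<in> C) \<longrightarrow> C' \<in> R)"
    using T'(1) T(2) by auto
next
  assume R: "R \<subseteq> subcovers \<and>
     (\<forall>C\<in>R. \<exists>n. \<forall>C'\<in>subcovers. C' \<subseteq> C \<and> (\<forall>i<n. a i \<in> C' \<longleftrightarrow> a i \<in> C) \<longrightarrow> C' \<in> R)"
  show "openin ellentuck R"
  proof (subst openin_subopen, intro ballI)
    fix C assume C: "C \<in> R"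
    then have CA: "C \<subseteq> A" "C \<in> Omega X" using R by (auto simp: inf_subsets_def)
    obtain n where n: "\<forall>C'\<in>subcovers. C' \<subseteq> C \<and> (\<forall>i<n. a i \<in> C' \<longleftrightarrow> a i \<in> C) \<longrightarrow> C' \<in> R"
      using bspec[OF conjunct2[OF R] C] by (elim exE)
    define s where "s = C \<inter> a ` {..<n}"
    define D where "D = C - a ` {..<n}"
    have D: "D \<in> Omega X" unfolding D_def using CA by (intro Omega_Diff_finite) auto
    have CsD: "C = s \<union> D" by (auto simp: s_def D_def)
    have sF: "s \<in> Fpow A" using CA by (auto simp: s_def Fpow_def)
    have DA: "D \<subseteq> A" using CA by (auto simp: D_def)
    have "enum_less a s D"
      using inj_eq[OF inj] by (auto simp: enum_less_def s_def D_def)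
    then have "openin ellentuck (ellentuck_set A s D \<inter> Omega X)"
      using sF DA Omega_infinite[OF D] by (intro openin_ellentuck_set)
    moreover have "C \<in> ellentuck_set A s D \<inter> Omega X"
      using CsD CA(2) Omega_inf_subsets[OF D DA countable_A] by (auto simp: ellentuck_set_def)
    moreover have "ellentuck_set A s D \<inter> Omega X \<subseteq> R"
    proof
      fix C' assume C': "C' \<in> ellentuck_set A s D \<inter> Omega X"
      then have sub: "s \<subseteq> C'" "C' \<subseteq> C" "C' \<in> Omega X" using CsD by (auto simp: ellentuck_set_def)
      then have "C' \<in> subcovers" using CA unfolding subcovers_iff by blast
      moreover have "\<forall>i<n. a i \<in> C' \<longleftrightarrow> a i \<in> C" using sub by (auto simp: s_def)
      ultimately show "C' \<in> R" using n sub by blast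
    qed
    ultimately show "\<exists>T. openin ellentuck T \<and> C \<in> T \<and> T \<subseteq> R" by blast
  qed
qed

section \<open>The Ellentuck theorem for omega-covers\<close>

lemma enum_above_image: "enum_above a (a ` S) (a ` s) = a ` tail S s"
  using inj_eq[OF inj] by (auto simp: enum_above_def enum_less_def tail_def)

lemma image_vimage: "C \<subseteq> A \<Longrightarrow> a ` (a -` C) = C"
  using range_a by auto

lemma vimage_in_H: "C \<subseteq> A \<Longrightarrow> C \<in> Omega X \<Longrightarrow> a -` C \<in> H"
  unfolding H_def mem_Collect_eq by (simp only: image_vimage)

text \<open>Removing a finite stem from a set in \<open>H\<close> leaves a set in \<open>H\<close>,
  which supplies the infinite part demanded by the Ellentuck set.\<close>

lemma image_ell:
  assumes sel: "selective_coideal H" and s: "finite s"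
  shows "(`) a ` selective_coideal.ell H s B = ellentuck_set A (a ` s) (a ` B) \<inter> Omega X"
proof -
  interpret selective_coideal H by (rule sel)
  show ?thesis
  proof (intro subset_antisym subsetI)
    fix D assume "D \<in> (`) a ` ell s B"
    then obtain C where C: "D = a ` C" "C \<in> H" "s \<subseteq> C" "C \<subseteq> s \<union> B" by (auto simp: ell_def)
    have "C - s \<in> H" using C(2) s by (rule Diff_finite)
    then have "a ` (C - s) \<in> Omega X" by (simp add: H_def)
    then have "a ` (C - s) \<in> inf_subsets A"
      using Omega_inf_subsets[OF _ _ countable_A] range_a by blast
    moreover have "a ` (C - s) \<subseteq> a ` B" "D = a ` s \<union> a ` (C - s)" using C by auto
    moreover have "D \<in> Omega X" using C by (simp add: H_def)
    ultimately show "D \<in> ellentuck_set A (a ` s) (a ` B) \<inter> Omega X"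
      unfolding ellentuck_set_def by blast
  next
    fix D assume D: "D \<in> ellentuck_set A (a ` s) (a ` B) \<inter> Omega X"
    then have DA: "D \<subseteq> A" "a ` s \<subseteq> D" "D \<subseteq> a ` s \<union> a ` B" "D \<in> Omega X"
      using range_a by (auto simp: ellentuck_set_def inf_subsets_def)
    then have "a -` D \<in> H" by (intro vimage_in_H)
    moreover have "s \<subseteq> a -` D" using DA by auto
    moreover have "a -` D \<subseteq> s \<union> B" using DA(3) inj_eq[OF inj] by auto
    ultimately have "a -` D \<in> ell s B" by (auto simp: ell_def)
    then show "D \<in> (`) a ` ell s B" using image_vimage[OF DA(1)] by (metis imageI)
  qed
qed

lemma enum_less_tail:
  assumes "B \<subseteq> tail S s"
  shows "enum_less a (a ` s) (a ` B)"
  using assms inj_eq[OF inj] by (auto simp: enum_less_def tail_def)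

text \<open>Shrinking past the meager part and then deciding the open part \<open>U\<close> reaches
  a neighbourhood on which \<open>R\<close> and \<open>U\<close> coincide.\<close>

lemma Baire_Ramsey:
  assumes S1: "S1 (Omega X) (Omega X)" and R: "baire_property_in ellentuck R"
    and S: "S \<subseteq> A" "S \<in> Omega X" and s: "s \<in> Fpow A"
  shows "\<exists>B. B \<subseteq> enum_above a S s \<and> infinite B \<and> B \<in> Omega X \<and>
              (ellentuck_set A s B \<inter> Omega X \<subseteq> R \<or> ellentuck_set A s B \<inter> Omega X \<inter> R = {})"
proof -
  have sel: "selective_coideal H" using S1 by (rule S1_selective_coideal)
  interpret selective_coideal H by (rule sel)
  have open': "ell_open {N. a ` N \<in> U}" if U: "openin ellentuck U" for U
    unfolding ell_open_def
  proof
    fix C assume "C \<in> {N. a ` N \<in> U}"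
    then have C: "a ` C \<in> U" by simp
    obtain n where n: "\<forall>C'\<in>subcovers. C' \<subseteq> a ` C \<and> (\<forall>i<n. a i \<in> C' \<longleftrightarrow> a i \<in> a ` C) \<longrightarrow> C' \<in> U"
      using bspec[OF conjunct2[OF iffD1[OF openin_ellentuck_iff U]] C] by (elim exE)
    have "a ` C' \<in> U" if "C' \<in> H" "C' \<subseteq> C" "C' \<inter> {..<n} = C \<inter> {..<n}" for C'
    proof -
      have "a ` C' \<in> subcovers" using that(1) range_a unfolding subcovers_iff by (auto simp: H_def)
      moreover have "\<forall>i<n. a i \<in> a ` C' \<longleftrightarrow> a i \<in> a ` C"
        using that(3) by (auto simp: inj_image_mem_iff[OF inj])
      moreover have "a ` C' \<subseteq> a ` C" using that(2) by (rule image_mono)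
      ultimately show ?thesis by (intro mp[OF bspec[OF n]] conjI)
    qed
    then show "\<exists>n. \<forall>C'\<in>H. C' \<subseteq> C \<and> C' \<inter> {..<n} = C \<inter> {..<n} \<longrightarrow> C' \<in> {N. a ` N \<in> U}" by auto
  qed
  \<comment> \<open>The dichotomy for open sets is applied to the complement of the closure of
    \<open>N\<close>. Its negative alternative would put a nonempty open set inside that
    closure.\<close>
  have null: "\<exists>B\<in>H. B \<subseteq> tail S s \<and> ell s B \<inter> {K. a ` K \<in> N} = {}"
    if N: "nowhere_dense_in ellentuck N" and s: "finite s" and S: "S \<in> H" for N s S
  proof -
    let ?K = "ellentuck closure_of N"
    have "openin ellentuck (topspace ellentuck - ?K)"
      by (intro openin_diff openin_topspace closedin_closure_of)
    from open_Ramsey[OF open'[OF this] S s] obtain B where B: "B \<in> H" "B \<subseteq> tail S s"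
      and dich: "ell s B \<subseteq> {K. a ` K \<in> topspace ellentuck - ?K} \<or>
         ell s B \<inter> {K. a ` K \<in> topspace ellentuck - ?K} = {}" by blast
    have NK: "N \<subseteq> ?K" using N by (simp add: nowhere_dense_in_def closure_of_subset)
    from dich show ?thesis
    proof
      assume "ell s B \<subseteq> {K. a ` K \<in> topspace ellentuck - ?K}"
      then show ?thesis using B NK by blast
    next
      assume *: "ell s B \<inter> {K. a ` K \<in> topspace ellentuck - ?K} = {}"
      let ?E = "ellentuck_set A (a ` s) (a ` B) \<inter> Omega X"
      have "openin ellentuck ?E"
      proof (rule openin_ellentuck_set)
        show "a ` s \<in> Fpow A" using s range_a by (auto simp: Fpow_def)
        show "a ` B \<subseteq> A" using range_a by auto
        show "infinite (a ` B)" using B(1) Omega_infinite by (auto simp: H_def)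
        show "enum_less a (a ` s) (a ` B)" using B(2) by (rule enum_less_tail)
      qed
      moreover have "?E \<subseteq> ?K"
      proof
        fix D assume D: "D \<in> ?E"
        then obtain C where "C \<in> ell s B" "D = a ` C" using image_ell[OF sel s, of B] by blast
        moreover have "D \<in> topspace ellentuck" using D \<open>openin ellentuck ?E\<close> openin_subset by blast
        ultimately show "D \<in> ?K" using * by blast
      qed
      ultimately have "?E \<subseteq> ellentuck interior_of ?K" by (simp add: interior_of_maximal)
      then have "?E = {}" using N by (simp add: nowhere_dense_in_def)
      moreover have "s \<union> B \<in> ell s B" using upward[OF B(1), of "s \<union> B"] by (auto simp: ell_def)
      ultimately show ?thesis using image_ell[OF sel s, of B] by blast
    qed
  qed
  obtain U M where U: "openin ellentuck U" and M: "meager_in ellentuck M" and RUM: "R = (U - M) \<union> (M - U)"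
    using R unfolding baire_property_in_def by blast
  obtain \<N> where \<N>: "countable \<N>" "\<And>N. N \<in> \<N> \<Longrightarrow> nowhere_dense_in ellentuck N" "M = \<Union>\<N>"
    using M unfolding meager_in_def by blast
  \<comment> \<open>Adding the empty set allows an empty family to be enumerated as well.\<close>
  define f where "f = from_nat_into (insert {} \<N>)"
  have rf: "range f = insert {} \<N>" using \<N>(1) by (simp add: f_def range_from_nat_into)
  have "nowhere_dense_in ellentuck (f n)" for n
  proof -
    have "f n \<in> insert {} \<N>" using rf by blast
    then show ?thesis using \<N>(2) by (auto simp: nowhere_dense_in_def)
  qed
  note nullf = null[OF this]
  define s' where "s' = a -` s"
  define S' where "S' = a -` S"
  have s': "finite s'" "a ` s' = s"
    unfolding s'_def using s inj range_a by (auto simp: Fpow_def intro: finite_vimageI)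
  have S': "S' \<in> H" "a ` S' = S"
    unfolding S'_def by (rule vimage_in_H[OF S], rule image_vimage[OF S(1)])
  have "\<exists>B\<in>H. B \<subseteq> tail S' s' \<and> ell s' B \<inter> (\<Union>n. {K. a ` K \<in> f n}) = {}"
    by (rule null_UN[OF nullf S'(1) s'(1)])
  then obtain B1 where B1: "B1 \<in> H" "B1 \<subseteq> tail S' s'" "ell s' B1 \<inter> (\<Union>n. {K. a ` K \<in> f n}) = {}"
    by (elim bexE conjE)
  obtain B where B: "B \<in> H" "B \<subseteq> tail B1 s'"
      "ell s' B \<subseteq> {K. a ` K \<in> U} \<or> ell s' B \<inter> {K. a ` K \<in> U} = {}"
    using open_Ramsey[OF open'[OF U] B1(1) s'(1)] by (elim bexE conjE)
  have BB1: "B \<subseteq> B1" using B(2) tail_subset by blast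
  have "M = (\<Union>n. f n)" using \<N>(3) rf by simp
  then have "a ` C \<notin> M" if "C \<in> ell s' B" for C
    using that B1(3) ell_mono[OF BB1, of s'] by blast
  then have "ell s' B \<subseteq> {K. a ` K \<in> R} \<or> ell s' B \<inter> {K. a ` K \<in> R} = {}"
    using B(3) RUM by blast
  then have "(`) a ` ell s' B \<subseteq> R \<or> (`) a ` ell s' B \<inter> R = {}" by auto
  then have "ellentuck_set A s (a ` B) \<inter> Omega X \<subseteq> R \<or> ellentuck_set A s (a ` B) \<inter> Omega X \<inter> R = {}"
    unfolding image_ell[OF sel s'(1), of B] s'(2) .
  moreover have "a ` B \<subseteq> enum_above a S s"
    using enum_above_image[of S' s'] s' S' B1(2) BB1 by auto
  moreover have "a ` B \<in> Omega X" using B(1) by (simp add: H_def)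
  ultimately show ?thesis using Omega_infinite by blast
qed

end

section \<open>The partition properties\<close>

context enumerated_cover
begin

text \<open>Elements of \<open>s - t\<close> and \<open>t - s\<close> would each have to precede the
  other.\<close>

lemma initial_segments_comparable:
  assumes "C \<subseteq> A" "initial_segment a s C" "initial_segment a t C"
  shows "s \<subseteq> t \<or> t \<subseteq> s"
proof (rule ccontr)
  assume "\<not> ?thesis"
  then obtain x y where xy: "x \<in> s - t" "y \<in> t - s" by blast
  then have "x \<in> C" "y \<in> C" using assms by (auto simp: initial_segment_def)
  then obtain i j where ij: "x = a i" "y = a j" using assms(1) range_a by blast
  have "i < j" using assms(2) xy ij \<open>y \<in> C\<close> unfolding initial_segment_def enum_less_def by blast
  moreover have "j < i" using assms(3) xy ij \<open>x \<in> C\<close> unfolding initial_segment_def enum_less_def by blast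
  ultimately show False by simp
qed

text \<open>Members of \<open>D\<close> with index below a bound for \<open>t\<close> are removed
  and \<open>t\<close> is put back. This turns statements about finite subsets of \<open>D\<close>
  into statements about initial segments of its subcovers.\<close>

lemma initial_segment_extension:
  assumes D: "D \<in> subcovers" and t: "t \<in> Fpow D"
  obtains C where "C \<in> inf_subsets D \<inter> Omega X" "initial_segment a t C"
proof -
  have tD: "finite t" "t \<subseteq> D" using t by (auto simp: Fpow_def)
  have DA: "D \<subseteq> A" "D \<in> Omega X" using D unfolding subcovers_iff by auto
  have "finite (a -` t)" using tD inj by (auto intro: finite_vimageI)
  then obtain n where n: "a -` t \<subseteq> {..<n}" using finite_nat_iff_bounded by auto
  define E where "E = D - a ` {..<n}"
  have E: "E \<in> Omega X" unfolding E_def using DA by (intro Omega_Diff_finite) auto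
  have "t \<union> E \<in> Omega X"
    using Omega_superset[OF E, of "t \<union> E" D] tD DA by (auto simp: E_def)
  then have "t \<union> E \<in> inf_subsets D \<inter> Omega X"
    by (rule Omega_inf_subsets) (use tD DA countable_A countable_subset in \<open>auto simp: E_def\<close>)
  moreover have "initial_segment a t (t \<union> E)"
    unfolding initial_segment_def enum_less_def
  proof (intro conjI allI impI)
    fix i j assume ij: "a i \<in> t" "a j \<in> t \<union> E - t"
    then have "i < n" using n by auto
    moreover have "\<not> j < n" using ij(2) by (auto simp: E_def)
    ultimately show "i < j" by simp
  qed (use tD in auto)
  ultimately show ?thesis using that by blast
qed

text \<open>Coordinates below a bound for the indices in \<open>s\<close> decide whether
  \<open>s\<close> is an initial segment; later elements lie above \<open>s\<close> anyway.\<close>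

lemma openin_cantor_initial_segment:
  assumes \<S>: "\<S> \<subseteq> Fpow A"
  shows "openin cantor {C \<in> subcovers. \<exists>s\<in>\<S>. initial_segment a s C}"
  unfolding openin_cantor_iff
proof (intro conjI ballI)
  fix C assume "C \<in> {C \<in> subcovers. \<exists>s\<in>\<S>. initial_segment a s C}"
  then obtain s where s: "s \<in> \<S>" "initial_segment a s C" by blast
  then have "s \<subseteq> A" "finite s" using \<S> by (auto simp: Fpow_def)
  have "finite (a -` s)" using \<open>finite s\<close> inj by (auto intro: finite_vimageI)
  then obtain n where n: "a -` s \<subseteq> {..<n}" using finite_nat_iff_bounded by auto
  have "initial_segment a s C'" if agree: "\<forall>i<n. a i \<in> C' \<longleftrightarrow> a i \<in> C" for C'
    unfolding initial_segment_def enum_less_def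
  proof (intro conjI allI impI subsetI)
    fix x assume x: "x \<in> s"
    then obtain i where i: "x = a i" using \<open>s \<subseteq> A\<close> range_a by blast
    then have "i < n" "a i \<in> C" using n x s(2) by (auto simp: initial_segment_def)
    then show "x \<in> C'" using agree i by blast
  next
    fix i j assume ij: "a i \<in> s" "a j \<in> C' - s"
    then have "i < n" using n by auto
    show "i < j"
    proof (cases "j < n")
      case True
      then have "a j \<in> C - s" using agree ij by blast
      then show ?thesis using s(2) ij(1) unfolding initial_segment_def enum_less_def by blast
    next
      case False
      then show ?thesis using \<open>i < n\<close> by simp
    qed
  qed (rule \<open>finite s\<close>)
  then show "\<exists>n. \<forall>C'\<in>subcovers. (\<forall>i<n. a i \<in> C' \<longleftrightarrow> a i \<in> C) \<longrightarrow>
      C' \<in> {C \<in> subcovers. \<exists>s\<in>\<S>. initial_segment a s C}"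
    using s(1) by (intro exI[of _ n]) blast
qed blast

end

section \<open>The implications between the selection principle and the partition properties\<close>

locale enumeration =
  fixes enum :: "'a set set \<Rightarrow> nat \<Rightarrow> 'a set"
  assumes enum: "\<And>A. countable A \<Longrightarrow> infinite A \<Longrightarrow> bij_betw (enum A) UNIV A"
begin

lemma enumerated_cover_enum: "A \<in> Omega X \<Longrightarrow> countable A \<Longrightarrow> enumerated_cover X A (enum A)"
  using enum Omega_infinite by unfold_locales auto

lemma S1_imp_E:
  assumes "S1 (Omega X) (Omega X)"
  shows "E_property enum X"
  unfolding E_property_def
proof (intro allI impI, elim conjE)
  fix A R S s
  assume cov: "A \<in> Omega X" "countable A"
    and *: "baire_property_in (subtopology (ellentuck_topology (enum A) A) (Omega X)) R"
    "S \<subseteq> A" "S \<in> Omega X" "s \<in> Fpow A"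
  interpret enumerated_cover X A "enum A" using cov by (rule enumerated_cover_enum)
  show "\<exists>B. B \<subseteq> enum_above (enum A) S s \<and> infinite B \<and> B \<in> Omega X \<and>
      (ellentuck_set A s B \<inter> Omega X \<subseteq> R \<or> ellentuck_set A s B \<inter> Omega X \<inter> R = {})"
    using Baire_Ramsey[OF assms *] .
qed

text \<open>Cantor-open sets are Ellentuck-open and so have the Baire property with empty meager
  part; the empty stem turns \<open>ellentuck_set A {} B\<close> into
  \<open>inf_subsets B\<close>.\<close>

lemma E_imp_GP:
  assumes E: "E_property enum X"
  shows "GP_property enum X"
  unfolding GP_property_def
proof (intro allI impI ballI, elim conjE)
  fix A R S
  assume cov: "A \<in> Omega X" "countable A" "infinite A" and R: "R \<subseteq> inf_subsets A \<inter> Omega X"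
    and opn: "openin (subtopology (cantor_topology (enum A) A) (Omega X)) R"
    and S: "S \<in> inf_subsets A \<inter> Omega X"
  interpret enumerated_cover X A "enum A" using cov(1,2) by (rule enumerated_cover_enum)
  have "openin ellentuck R"
    unfolding openin_ellentuck_iff
  proof (intro conjI ballI R)
    fix C assume C: "C \<in> R"
    obtain n where "\<forall>C'\<in>subcovers. (\<forall>i<n. enum A i \<in> C' \<longleftrightarrow> enum A i \<in> C) \<longrightarrow> C' \<in> R"
      using bspec[OF conjunct2[OF iffD1[OF openin_cantor_iff opn]] C] by (elim exE)
    then show "\<exists>n. \<forall>C'\<in>subcovers. C' \<subseteq> C \<and> (\<forall>i<n. enum A i \<in> C' \<longleftrightarrow> enum A i \<in> C) \<longrightarrow> C' \<in> R"
      by (intro exI[of _ n]) simp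
  qed
  moreover have "meager_in ellentuck {}" unfolding meager_in_def by (intro exI[of _ "{}"]) simp
  ultimately have "baire_property_in ellentuck R"
    unfolding baire_property_in_def by (intro exI[of _ R] exI[of _ "{}"]) simp
  moreover have "S \<subseteq> A" "S \<in> Omega X" "{} \<in> Fpow A" using S by (auto simp: inf_subsets_def Fpow_def)
  ultimately obtain B where B: "B \<subseteq> enum_above (enum A) S {}" "B \<in> Omega X"
    "ellentuck_set A {} B \<inter> Omega X \<subseteq> R \<or> ellentuck_set A {} B \<inter> Omega X \<inter> R = {}"
    using E cov R unfolding E_property_def by metis
  have BS: "B \<subseteq> S" using B(1) by (auto simp: enum_above_def)
  then have "ellentuck_set A {} B = inf_subsets B"
    using \<open>S \<subseteq> A\<close> by (auto simp: ellentuck_set_def inf_subsets_def)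
  moreover have "countable S" using S by (simp add: inf_subsets_def)
  ultimately show "\<exists>B\<in>inf_subsets S \<inter> Omega X.
      inf_subsets B \<inter> Omega X \<subseteq> R \<or> inf_subsets B \<inter> Omega X \<inter> R = {}"
    using B Omega_inf_subsets[OF B(2) BS] by (intro bexI[of _ B]) auto
qed

text \<open>The common source of the Galvin and Nash-Williams properties. If \<open>B\<close> avoids
  the open set, a member of the family contained in \<open>B\<close> would be an initial segment of
  some subcover of \<open>B\<close>, a contradiction.\<close>

lemma GP_dichotomy:
  assumes GP: "GP_property enum X" and cov: "A \<in> Omega X" "countable A" and \<S>: "\<S> \<subseteq> Fpow A"
    and S: "S \<in> inf_subsets A \<inter> Omega X"
  obtains B where "B \<in> inf_subsets S \<inter> Omega X"
      "\<And>C. C \<in> inf_subsets B \<inter> Omega X \<Longrightarrow> \<exists>s\<in>\<S>. initial_segment (enum A) s C"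
    | B where "B \<in> inf_subsets S \<inter> Omega X" "\<S> \<inter> Fpow B = {}"
proof -
  interpret enumerated_cover X A "enum A" using cov by (rule enumerated_cover_enum)
  let ?R = "{C \<in> subcovers. \<exists>s\<in>\<S>. initial_segment (enum A) s C}"
  obtain B where B: "B \<in> inf_subsets S \<inter> Omega X"
    and dich: "inf_subsets B \<inter> Omega X \<subseteq> ?R \<or> inf_subsets B \<inter> Omega X \<inter> ?R = {}"
    using GP[unfolded GP_property_def, rule_format, of A ?R S] cov S Omega_infinite[OF cov(1)]
      openin_cantor_initial_segment[OF \<S>] by blast
  have BA: "B \<in> subcovers" using B S by (auto simp: inf_subsets_def)
  from dich show ?thesis
  proof
    assume "inf_subsets B \<inter> Omega X \<subseteq> ?R"
    then show ?thesis using that(1)[OF B] by blast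
  next
    assume disj: "inf_subsets B \<inter> Omega X \<inter> ?R = {}"
    have "t \<notin> Fpow B" if t: "t \<in> \<S>" for t
    proof
      assume "t \<in> Fpow B"
      with BA obtain C where C: "C \<in> inf_subsets B \<inter> Omega X" "initial_segment (enum A) t C"
        by (rule initial_segment_extension)
      then have "C \<in> subcovers" using BA by (auto simp: inf_subsets_def)
      then show False using C t disj by blast
    qed
    then show ?thesis using that(2)[OF B] by blast
  qed
qed

lemma GP_imp_FG:
  assumes GP: "GP_property enum X"
  shows "FG_property enum X"
  unfolding FG_property_def
proof (intro allI impI, elim conjE)
  fix A \<S>
  assume cov: "A \<in> Omega X" "countable A" and \<S>: "\<S> \<subseteq> Fpow A" and dense: "dense_family X A \<S>"
  have "A \<in> inf_subsets A \<inter> Omega X" using cov Omega_inf_subsets by blast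
  with GP cov \<S> show "\<exists>B\<in>inf_subsets A \<inter> Omega X. \<forall>C\<in>inf_subsets B \<inter> Omega X.
      \<exists>s\<in>\<S>. initial_segment (enum A) s C"
  proof (cases rule: GP_dichotomy)
    case (1 B)
    then show ?thesis by blast
  next
    case (2 B)
    then show ?thesis using dense unfolding dense_family_def by blast
  qed
qed

text \<open>Induction on the set \<open>I\<close> of classes that may still occur. Either
  \<open>P i\<close> disappears from a subcover, or all further subcovers start with a member of
  \<open>P i\<close>, and thinness then leaves no room for the other classes.\<close>

lemma GP_imp_NW:
  assumes GP: "GP_property enum X"
  shows "NW_property enum X"
  unfolding NW_property_def
proof (intro allI impI, elim conjE)
  fix A \<T> and n :: nat and P
  assume cov: "A \<in> Omega X" "countable A" and \<T>: "\<T> \<subseteq> Fpow A" and thin: "thin (enum A) \<T>"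
    and n: "1 \<le> n" and P: "\<T> = (\<Union>i\<in>{1..n}. P i)"
  interpret enumerated_cover X A "enum A" using cov by (rule enumerated_cover_enum)
  have "\<exists>B\<in>subcovers. \<exists>i\<in>I. Fpow B \<inter> \<T> \<subseteq> P i"
    if "finite I" "I \<noteq> {}" "I \<subseteq> {1..n}" "S \<in> subcovers" "Fpow S \<inter> \<T> \<subseteq> (\<Union>i\<in>I. P i)" for I S
    using that
  proof (induction I arbitrary: S rule: finite_ne_induct)
    case (singleton i)
    then show ?case by auto
  next
    case (insert i I)
    have "P i \<subseteq> Fpow A" using \<T> P insert by blast
    with GP cov show ?case using insert(6)
    proof (cases rule: GP_dichotomy)
      case (1 B)
      then have B: "B \<in> subcovers" using insert(6) by (auto simp: inf_subsets_def)
      \<comment> \<open>\<open>t\<close> and some \<open>s\<close> in \<open>P i\<close> start the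
        same \<open>C\<close>, so one starts the other and thinness makes them equal.\<close>
      have "t \<in> P i" if t: "t \<in> Fpow B" "t \<in> \<T>" for t
      proof -
        obtain C where C: "C \<in> inf_subsets B \<inter> Omega X" "initial_segment (enum A) t C"
          using B t(1) by (rule initial_segment_extension)
        obtain s where s: "s \<in> P i" "initial_segment (enum A) s C" using 1(2)[OF C(1)] by blast
        have "C \<subseteq> A" using C B by (auto simp: inf_subsets_def)
        then have "s \<subseteq> t \<or> t \<subseteq> s" using initial_segments_comparable s(2) C(2) by blast
        then have "initial_segment (enum A) s t \<or> initial_segment (enum A) t s"
          using s(2) C(2) unfolding initial_segment_def enum_less_def by blast
        moreover have "s \<in> \<T>" using s(1) P insert by blast
        ultimately have "s = t" using thin t(2) unfolding thin_def by metis
        then show ?thesis using s by simp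
      qed
      then show ?thesis using B by blast
    next
      case (2 B)
      then have B: "B \<in> subcovers" "B \<subseteq> S" using insert(6) by (auto simp: inf_subsets_def)
      have "Fpow B \<inter> \<T> \<subseteq> (\<Union>i\<in>I. P i)"
        using insert(7) 2(2) Fpow_mono[OF B(2)] by blast
      then show ?thesis using insert.IH[OF _ B(1)] insert(5) by blast
    qed
  qed
  from this[of "{1..n}" A] show "\<exists>B\<in>subcovers. \<exists>i\<in>{1..n}. Fpow B \<inter> \<T> \<subseteq> P i"
    using n P cov Omega_inf_subsets[OF cov(1) subset_refl cov(2)] by auto
qed

text \<open>An initial segment of equal finite size is the whole set, so the
  \<open>n\<close>-element sets are thin and the colour classes partition them.\<close>

lemma NW_imp_arrow:
  assumes NW: "NW_property enum X" and k: "1 \<le> k"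
  shows "omega_arrow X n k"
  unfolding omega_arrow_def
proof (intro allI impI, elim conjE)
  fix A f
  assume cov: "A \<in> Omega X" "countable A" and f: "f \<in> nsets A n \<rightarrow> {1..k}"
  define P where "P i = {p \<in> nsets A n. f p = i}" for i
  have "nsets A n \<subseteq> Fpow A" by (auto simp: nsets_def Fpow_def)
  moreover have "thin (enum A) (nsets A n)"
    unfolding thin_def initial_segment_def nsets_def using card_subset_eq by blast
  moreover have "nsets A n = (\<Union>i\<in>{1..k}. P i)" using f by (auto simp: P_def)
  moreover have "disjoint_family_on P {1..k}" by (auto simp: disjoint_family_on_def P_def)
  ultimately obtain B i where B: "B \<in> inf_subsets A \<inter> Omega X" "i \<in> {1..k}" "Fpow B \<inter> nsets A n \<subseteq> P i"
    using NW cov k Omega_infinite[OF cov(1)] unfolding NW_property_def by metis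
  have "f p = i" if "p \<in> nsets B n" for p
  proof -
    have "p \<in> Fpow B \<inter> nsets A n" using that B(1) by (auto simp: nsets_def Fpow_def inf_subsets_def)
    then show ?thesis using B(3) by (auto simp: P_def)
  qed
  then show "\<exists>B\<in>inf_subsets A \<inter> Omega X. \<exists>i\<in>{1..k}. \<forall>p\<in>nsets B n. f p = i"
    using B by blast
qed

text \<open>The dense family to try is that of the pairs of colour 1. If it is dense, each pair in
  the resulting \<open>B\<close> starts a subcover whose unique two-element initial segment has
  colour 1; if not, a witness contains no pair of colour 1.\<close>

lemma FG_imp_arrow:
  assumes FG: "FG_property enum X"
  shows "omega_arrow X 2 2"
  unfolding omega_arrow_def
proof (intro allI impI, elim conjE)
  fix A f
  assume cov: "A \<in> Omega X" "countable A" and f: "f \<in> nsets A 2 \<rightarrow> {1..2::nat}"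
  interpret enumerated_cover X A "enum A" using cov by (rule enumerated_cover_enum)
  define P where "P = {p \<in> nsets A 2. f p = 1}"
  have PA: "P \<subseteq> Fpow A" by (auto simp: P_def nsets_def Fpow_def)
  show "\<exists>B\<in>subcovers. \<exists>i\<in>{1..2}. \<forall>p\<in>nsets B 2. f p = i"
  proof (cases "dense_family X A P")
    case True
    then obtain B where B: "B \<in> subcovers"
      and seg: "\<And>C. C \<in> inf_subsets B \<inter> Omega X \<Longrightarrow> \<exists>s\<in>P. initial_segment (enum A) s C"
      using FG cov PA Omega_infinite[OF cov(1)] unfolding FG_property_def by metis
    have "f p = 1" if p: "p \<in> nsets B 2" for p
    proof -
      have "p \<in> Fpow B" using p by (auto simp: nsets_def Fpow_def)
      with B obtain C where C: "C \<in> inf_subsets B \<inter> Omega X" "initial_segment (enum A) p C"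
        by (rule initial_segment_extension)
      obtain q where q: "q \<in> P" "initial_segment (enum A) q C" using seg[OF C(1)] by blast
      have "C \<subseteq> A" using C B by (auto simp: inf_subsets_def)
      then have "p \<subseteq> q \<or> q \<subseteq> p" using initial_segments_comparable q(2) C(2) by blast
      moreover have "finite p" "finite q" "card p = 2" "card q = 2" using p q by (auto simp: P_def nsets_def)
      ultimately have "p = q" by (metis card_subset_eq)
      then show ?thesis using q by (simp add: P_def)
    qed
    then show ?thesis using B by (intro bexI[of _ B] bexI[of _ 1]) auto
  next
    case False
    then obtain B where B: "B \<in> subcovers" "P \<inter> Fpow B = {}" by (auto simp: dense_family_def)
    have "f p = 2" if p: "p \<in> nsets B 2" for p
    proof -
      have pA: "p \<in> nsets A 2" "p \<in> Fpow B" using p B(1) by (auto simp: nsets_def Fpow_def inf_subsets_def)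
      then have "f p \<noteq> 1" using B(2) by (auto simp: P_def)
      moreover have "f p \<in> {1..2}" using f pA by blast
      ultimately show ?thesis by auto
    qed
    then show ?thesis using B by (intro bexI[of _ B] bexI[of _ 2]) auto
  qed
qed

end

text \<open>A subcover homogeneous for colour 2 takes at most one member from each row and so is a
  partial selector. Enlarging its members \<open>u 0 n \<inter> u n m\<close> to
  \<open>u n m\<close> and filling the missing rows keeps every finite set covered.\<close>

lemma arrow_imp_S1:
  assumes eps: "epsilon_space X" and arrow: "omega_arrow X 2 2"
  shows "S1 (Omega X) (Omega X)"
  unfolding S1_def
proof (intro allI impI)
  fix \<U> :: "nat \<Rightarrow> 'a set set"
  assume \<U>: "\<forall>n. \<U> n \<in> Omega X"
  have "\<forall>n. \<exists>\<V>\<subseteq>\<U> n. countable \<V> \<and> \<V> \<in> Omega X" using eps \<U> by (auto simp: epsilon_space_def)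
  then obtain \<V> where \<V>: "\<And>n. \<V> n \<subseteq> \<U> n" "\<And>n. countable (\<V> n)" "\<And>n. \<V> n \<in> Omega X" by metis
  \<comment> \<open>Enumerating the countable subcovers obtained from \<open>epsilon_space X\<close>
    is what makes \<open>A\<close> countable, as the arrow relation demands.\<close>
  define u where "u n = from_nat_into (\<V> n)" for n
  have u: "range (u n) = \<V> n" for n
    using \<V>(2,3)[of n] Omega_infinite[of "\<V> n" X] by (auto simp: u_def intro!: range_from_nat_into)
  text \<open>Intersecting with the \<open>n\<close>-th member \<open>u 0 n\<close> of the first cover keeps each family
    \<open>{w (n, m) | m}\<close> from being an omega-cover, so no homogeneous set stays in a single row.\<close>
  define w where "w = (\<lambda>(n, m). u 0 n \<inter> u n m)"
  define A where "A = range w"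
  have row: "w nm \<subseteq> u 0 (fst nm)" "w nm \<subseteq> u (fst nm) (snd nm)" for nm
    by (auto simp: w_def split: prod.split)
  have uV: "u n m \<in> \<V> n" for n m using u by blast
  have cover: "\<exists>m. F \<subseteq> u n m" if F: "finite F" "F \<subseteq> topspace X" for F n
  proof -
    obtain U where U: "U \<in> \<V> n" "F \<subseteq> U" using F Omega_finite_subset[OF \<V>(3)] by blast
    then have "U \<in> range (u n)" using u by simp
    then show ?thesis using U(2) by blast
  qed
  have A\<Omega>: "A \<in> Omega X"
    unfolding Omega_iff
  proof (intro conjI ballI allI impI notI)
    fix U assume "U \<in> A"
    then show "openin X U" using Omega_openin[OF \<V>(3) uV] by (auto simp: A_def w_def)
  next
    assume "topspace X \<in> A"
    then obtain nm where "topspace X = w nm" by (auto simp: A_def)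
    then show False using row(1)[of nm] Omega_not_topspace[OF \<V>(3) uV] by metis
  next
    fix F assume F: "finite F \<and> F \<subseteq> topspace X"
    then obtain n where n: "F \<subseteq> u 0 n" using cover by blast
    obtain m where "F \<subseteq> u n m" using cover F by blast
    then have "F \<subseteq> w (n, m)" using n by (auto simp: w_def)
    then show "\<exists>U\<in>A. F \<subseteq> U" by (auto simp: A_def)
  qed
  \<comment> \<open>A set in \<open>A\<close> may arise in several rows; \<open>r\<close> fixes one
    representation, so that its row is well defined.\<close>
  define r where "r U = (SOME nm. w nm = U)" for U
  have r: "w (r U) = U" if "U \<in> A" for U
    using that someI[of "\<lambda>nm. w nm = U"] by (auto simp: A_def r_def)
  define f where "f p = (if \<exists>n. \<forall>U\<in>p. fst (r U) = n then 1 else 2 :: nat)" for p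
  have "countable A" by (simp add: A_def)
  moreover have "f \<in> nsets A 2 \<rightarrow> {1..2}" by (auto simp: f_def)
  ultimately have "\<exists>B\<in>inf_subsets A \<inter> Omega X. \<exists>i\<in>{1..2}. \<forall>p\<in>nsets B 2. f p = i"
    using arrow[unfolded omega_arrow_def, rule_format, of A f] A\<Omega> by blast
  then obtain B i where B: "B \<in> inf_subsets A \<inter> Omega X"
    and hom: "\<And>p. p \<in> nsets B 2 \<Longrightarrow> f p = i" by blast
  have BA: "B \<subseteq> A" and B\<Omega>: "B \<in> Omega X" using B by (auto simp: inf_subsets_def)
  have pair: "{U, V} \<in> nsets B 2" if "U \<in> B" "V \<in> B" "U \<noteq> V" for U V
    using that by (simp add: nsets_def)
  have "i \<noteq> 1"
  proof
    assume i: "i = 1"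
    obtain U where U: "U \<in> B" using Omega_infinite[OF B\<Omega>] by (metis ex_in_conv finite.emptyI)
    have same: "fst (r V) = fst (r U)" if V: "V \<in> B" for V
    proof (cases "V = U")
      case False
      then have "f {U, V} = 1" using hom[OF pair[of U V]] U V i by simp
      then show ?thesis by (auto simp: f_def split: if_splits)
    qed simp
    have sub: "V \<subseteq> u 0 (fst (r U))" if V: "V \<in> B" for V
      using row(1)[of "r V"] r[of V] V BA same[OF V] by auto
    have "topspace X \<subseteq> u 0 (fst (r U))"
    proof
      fix x assume "x \<in> topspace X"
      then obtain V where "V \<in> B" "{x} \<subseteq> V" using Omega_finite_subset[OF B\<Omega>, of "{x}"] by auto
      then show "x \<in> u 0 (fst (r U))" using sub by blast
    qed
    then show False using Omega_not_topspace[OF \<V>(3) uV] by blast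
  qed
  have inj: "inj_on (\<lambda>U. fst (r U)) B"
  proof (rule inj_onI, rule ccontr)
    fix U V assume UV: "U \<in> B" "V \<in> B" "fst (r U) = fst (r V)" "U \<noteq> V"
    then have "f {U, V} = 1" by (auto simp: f_def)
    then show False using hom[OF pair[of U V]] UV \<open>i \<noteq> 1\<close> by simp
  qed
  \<comment> \<open>Rows without a member of \<open>B\<close> receive the arbitrary choice
    \<open>u n 0\<close>.\<close>
  define v where "v n = (if n \<in> (\<lambda>U. fst (r U)) ` B
      then u n (snd (r (the_inv_into B (\<lambda>U. fst (r U)) n))) else u n 0)" for n
  have v: "v (fst (r U)) = u (fst (r U)) (snd (r U))" if "U \<in> B" for U
    using that the_inv_into_f_f[OF inj that] by (simp add: v_def)
  have v\<U>: "v n \<in> \<V> n" for n using uV by (simp add: v_def)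
  have "range v \<in> Omega X"
    unfolding Omega_iff
  proof (intro conjI ballI allI impI notI)
    fix U assume "U \<in> range v"
    then show "openin X U" using Omega_openin[OF \<V>(3) v\<U>] by auto
  next
    assume "topspace X \<in> range v"
    then show False using Omega_not_topspace[OF \<V>(3) v\<U>] by auto
  next
    fix F assume "finite F \<and> F \<subseteq> topspace X"
    then obtain U where U: "U \<in> B" "F \<subseteq> U" using Omega_finite_subset[OF B\<Omega>] by blast
    then have "F \<subseteq> v (fst (r U))" using row(2)[of "r U"] r[of U] BA v[of U] by auto
    then show "\<exists>U\<in>range v. F \<subseteq> U" by blast
  qed
  then show "\<exists>u. (\<forall>n. u n \<in> \<U> n) \<and> range u \<in> Omega X" using v\<U> \<V>(1) by blast
qed

theorem theorem2:
  fixes X :: "'a topology"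
    and enum :: "'a set set \<Rightarrow> nat \<Rightarrow> 'a set"
  assumes "\<And>A. countable A \<Longrightarrow> infinite A \<Longrightarrow> bij_betw (enum A) UNIV A"
    and "epsilon_space X"
  shows "(S1 (Omega X) (Omega X) \<longleftrightarrow> E_property enum X) \<and>
         (E_property enum X \<longleftrightarrow> GP_property enum X) \<and>
         (GP_property enum X \<longleftrightarrow> FG_property enum X) \<and>
         (FG_property enum X \<longleftrightarrow> NW_property enum X) \<and>
         (NW_property enum X \<longleftrightarrow> (\<forall>n k. n \<ge> 1 \<and> k \<ge> 1 \<longrightarrow> omega_arrow X n k)) \<and>
         ((\<forall>n k. n \<ge> 1 \<and> k \<ge> 1 \<longrightarrow> omega_arrow X n k) \<longleftrightarrow> omega_arrow X 2 2)"
proof -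
  interpret enumeration enum by unfold_locales (fact assms(1))
  have "NW_property enum X \<Longrightarrow> \<forall>n k. n \<ge> 1 \<and> k \<ge> 1 \<longrightarrow> omega_arrow X n k"
    using NW_imp_arrow by blast
  moreover have "(\<forall>n k. n \<ge> 1 \<and> k \<ge> 1 \<longrightarrow> omega_arrow X n k) \<Longrightarrow> omega_arrow X 2 2" by simp
  \<comment> \<open>The cycle runs through \<open>E_property\<close>, \<open>GP_property\<close>,
    \<open>FG_property\<close> and pairs back to \<open>S1\<close>; a second path leads from
    \<open>GP_property\<close> through \<open>NW_property\<close> and all \<open>n\<close>,
    \<open>k\<close> to pairs.\<close>
  ultimately show ?thesis
    using S1_imp_E[of X] E_imp_GP[of X] GP_imp_FG[of X] FG_imp_arrow[of X] GP_imp_NW[of X]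
      arrow_imp_S1[OF assms(2)] by argo
qed

end
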